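(* There exist absolute constants $c_*>0$ and $K>0$ such that for every integer $d\geqslant 1$, $$\bigl| i(H^{mod}_d) - 3\cdot 4^d - d\cdot 3^{d+1}\bigr| \leqslant K(3-c_* )^d .$$ In particular, $i(H^{mod}_d) = 3\cdot 4^d + O((4-c_* )^d)$.
   Context: For a hypergraph $H=(V,E)$, a set $W\subseteq V$ is independent if no edge $e\in E$ satisfies $e\subseteq W$; $i(H)$ denotes the number of independent sets of $H$ (the empty set included). The hypergraph $H^{mod}_d=(V,E)$ has vertex set $V=V_1\sqcup V_2\sqcup V_3$, where each $V_i$ is a disjoint copy of the cyclic group $\mathbb{Z}/d\mathbb{Z}$, and edge set $E=\{\{x,y,z\}: x\in V_1,\ y\in V_2,\ z\in V_3,\ x+y\equiv z \pmod d\}$. It is $3$-uniform, $d$-regular and linear. *)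

theory Defs
  imports Complex_Main
begin

definition independent_set :: "'a set \<Rightarrow> 'a set set \<Rightarrow> 'a set \<Rightarrow> bool" where
  "independent_set V E W \<longleftrightarrow> W \<subseteq> V \<and> (\<forall>e\<in>E. \<not> e \<subseteq> W)"

definition num_indep :: "'a set \<Rightarrow> 'a set set \<Rightarrow> nat" where
  "num_indep V E = card {W. independent_set V E W}"

text \<open>H^mod_d: vertex set V1 + V2 + V3, with V_i = {(i,x) | x < d} a copy of Z/dZ
  (i = 0,1,2); edges {(0,x),(1,y),(2,z)} with x + y = z mod d.\<close>

definition Hmod_V :: "nat \<Rightarrow> (nat \<times> nat) set" where
  "Hmod_V d = {0,1,2} \<times> {..<d}"

definition Hmod_E :: "nat \<Rightarrow> (nat \<times> nat) set set" where
  "Hmod_E d = {{(0,x),(1,y),(2,z)} | x y z. x < d \<and> y < d \<and> z < d \<and> (x + y) mod d = z}"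

definition i_Hmod :: "nat \<Rightarrow> nat" where
  "i_Hmod d = num_indep (Hmod_V d) (Hmod_E d)"

end

theory Submission
  imports Defs "HOL-Library.FuncSet" "HOL-Real_Asymp.Real_Asymp"
begin

text \<open>
  An independent set is a triple \<open>(A, B, C)\<close> of subsets of \<open>V = {..<d}\<close> avoiding the Latin square
  \<open>x + y = z\<close>. Triples with \<open>card A \<le> 1\<close> number exactly \<open>4 ^ d + d * 3 ^ d\<close>, and likewise for \<open>B\<close>
  and \<open>C\<close>; this gives the main term, with a double count of order \<open>d\<^sup>2 * 2 ^ d\<close>.

  If \<open>2 \<le> card A \<le> \<epsilon> * d\<close>, there are few choices of \<open>A\<close>. Two elements of \<open>A\<close> give a derangement
  \<open>p\<close> of \<open>V\<close>, and the constraints on \<open>d / 3\<close> disjoint pairs \<open>{y, p y}\<close> leave at most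
  \<open>(8 / 9) ^ (d / 3) * 3 ^ d \<le> 2.9 ^ d\<close> pairs \<open>(B, C)\<close>.

  If all three sets have at least \<open>\<epsilon> * d\<close> elements, a container argument puts the triple into
  one of few triples \<open>(A', B', C')\<close> spanning fewer than \<open>\<delta> * d\<^sup>2\<close> edges. Since \<open>A'\<close> is large,
  \<open>card B' + card C'\<close> cannot much exceed \<open>d\<close>; by symmetry the total size is at most about
  \<open>3 / 2 * d\<close>, so a container holds roughly \<open>2 ^ (3 / 2 * d) < 2.9 ^ d\<close> triples.
\<close>

section \<open>Small subsets of a finite set\<close>

lemma sum_power_card_Pow:
  fixes t :: "'b::comm_semiring_1"
  assumes "finite V"
  shows "(\<Sum>S\<in>Pow V. t ^ card S) = (1 + t) ^ card V"
  using assms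
proof induction
  case empty
  then show ?case by simp
next
  case (insert v V)
  have inj: "inj_on (insert v) (Pow V)"
    using insert.hyps by (auto simp: inj_on_def)
  have "(\<Sum>S\<in>Pow (insert v V). t ^ card S)
      = (\<Sum>S\<in>Pow V. t ^ card S) + (\<Sum>S\<in>insert v ` Pow V. t ^ card S)"
    unfolding Pow_insert using insert.hyps by (intro sum.union_disjoint) auto
  also have "(\<Sum>S\<in>insert v ` Pow V. t ^ card S) = (\<Sum>S\<in>Pow V. t ^ card (insert v S))"
    using inj by (simp add: sum.reindex)
  also have "\<dots> = (\<Sum>S\<in>Pow V. t * t ^ card S)"
  proof (rule sum.cong)
    fix S assume "S \<in> Pow V"
    with insert.hyps have "finite S" "v \<notin> S" by (auto intro: finite_subset)
    then show "t ^ card (insert v S) = t * t ^ card S" by simp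
  qed simp
  finally show ?case
    using insert by (simp add: sum_distrib_left [symmetric] algebra_simps)
qed

definition small_subsets :: "'a set \<Rightarrow> real \<Rightarrow> 'a set set" where
  "small_subsets V m = {S. S \<subseteq> V \<and> real (card S) \<le> m}"

lemma finite_small_subsets: "finite V \<Longrightarrow> finite (small_subsets V m)"
  unfolding small_subsets_def by (rule finite_subset [of _ "Pow V"]) auto

text \<open>Weighting every subset \<open>S\<close> by \<open>t ^ card S\<close> gives total weight
  \<open>(1 + t) ^ card V\<close>, while a set of size at most \<open>t * card V\<close> weighs at
  least \<open>t powr (t * card V)\<close>. The count is thus at most
  \<open>((1 + t) * t powr (- t)) ^ card V\<close>, and this base tends to 1 as \<open>t\<close>
  tends to 0.\<close>

lemma card_small_subsets_le:
  fixes q :: real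
  assumes "q > 1"
  obtains \<epsilon> :: real where "\<epsilon> > 0"
    "\<And>V :: 'a set. finite V \<Longrightarrow> real (card (small_subsets V (\<epsilon> * card V))) \<le> q ^ card V"
proof -
  have "((\<lambda>t::real. (1 + t) * t powr (- t)) \<longlongrightarrow> 1) (at_right 0)"
    by real_asymp
  then have "\<forall>\<^sub>F t in at_right (0::real). (1 + t) * t powr (- t) < q"
    using assms by (rule order_tendstoD)
  then obtain b where b: "b > 0" "\<And>t. 0 < t \<Longrightarrow> t < b \<Longrightarrow> (1 + t) * t powr (- t) < q"
    unfolding eventually_at_right_field by auto
  \<comment> \<open>The cap at 1 makes powers of \<open>t\<close> decrease in the exponent. The same
    \<open>t\<close> serves as weight and as the threshold \<open>\<epsilon>\<close>.\<close>
  define t where "t = min (b / 2) 1"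
  have t: "0 < t" "t \<le> 1" "(1 + t) * t powr (- t) < q"
    using b by (auto simp: t_def min_def)
  show thesis
  proof (rule that)
    show "t > 0" by fact
    fix V :: "'a set" assume V: "finite V"
    let ?d = "card V" and ?F = "small_subsets V (t * card V)"
    have "(t powr t) ^ ?d = t powr (t * ?d)"
      using t powr_realpow [of "t powr t" ?d] by (simp only: powr_powr powr_gt_zero)
    then have "real (card ?F) * (t powr t) ^ ?d = (\<Sum>S\<in>?F. t powr (t * ?d))"
      by simp
    also have "\<dots> \<le> (\<Sum>S\<in>?F. t ^ card S)"
    proof (rule sum_mono)
      fix S assume "S \<in> ?F"
      then show "t powr (t * ?d) \<le> t ^ card S"
        using t by (simp add: small_subsets_def powr_realpow [symmetric] powr_mono')
    qed
    also have "\<dots> \<le> (\<Sum>S\<in>Pow V. t ^ card S)"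
      using V t by (intro sum_mono2) (auto simp: small_subsets_def)
    also have "\<dots> = (1 + t) ^ ?d" using V by (rule sum_power_card_Pow)
    finally have "real (card ?F) \<le> ((1 + t) / t powr t) ^ ?d"
      using t by (simp add: power_divide pos_le_divide_eq)
    also have "\<dots> = ((1 + t) * t powr (- t)) ^ ?d"
      using t by (simp add: powr_minus field_simps)
    also have "\<dots> \<le> q ^ ?d"
      using t by (intro power_mono) auto
    finally show "real (card ?F) \<le> q ^ ?d" .
  qed
qed

section \<open>Latin squares and avoiding triples\<close>

definition avoids :: "('a \<Rightarrow> 'a \<Rightarrow> 'a \<Rightarrow> bool) \<Rightarrow> 'a set \<Rightarrow> 'a set \<Rightarrow> 'a set \<Rightarrow> bool" where
  "avoids R A B C \<longleftrightarrow> (\<forall>x\<in>A. \<forall>y\<in>B. \<forall>z\<in>C. \<not> R x y z)"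

definition avoiding_triples ::
    "'a set \<Rightarrow> ('a \<Rightarrow> 'a \<Rightarrow> 'a \<Rightarrow> bool) \<Rightarrow> ('a set \<times> 'a set \<times> 'a set) set" where
  "avoiding_triples V R = {(A, B, C). A \<subseteq> V \<and> B \<subseteq> V \<and> C \<subseteq> V \<and> avoids R A B C}"

definition avoiding_pairs ::
    "'a set \<Rightarrow> ('a \<Rightarrow> 'a \<Rightarrow> 'a \<Rightarrow> bool) \<Rightarrow> 'a set \<Rightarrow> ('a set \<times> 'a set) set" where
  "avoiding_pairs V R A = {(B, C). B \<subseteq> V \<and> C \<subseteq> V \<and> avoids R A B C}"

lemma avoiding_pairs_anti_mono: "A' \<subseteq> A \<Longrightarrow> avoiding_pairs V R A \<subseteq> avoiding_pairs V R A'"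
  by (auto simp: avoiding_pairs_def avoids_def)

lemma finite_avoiding_triples: "finite V \<Longrightarrow> finite (avoiding_triples V R)"
  by (rule finite_subset [of _ "Pow V \<times> Pow V \<times> Pow V"]) (auto simp: avoiding_triples_def)

lemma finite_avoiding_pairs: "finite V \<Longrightarrow> finite (avoiding_pairs V R A)"
  by (rule finite_subset [of _ "Pow V \<times> Pow V"]) (auto simp: avoiding_pairs_def)

lemma card_avoiding_triples_le:
  assumes "finite V"
  shows "card (avoiding_triples V R) \<le> 8 ^ card V"
proof -
  have "card (avoiding_triples V R) \<le> card (Pow V \<times> Pow V \<times> Pow V)"
    using assms by (intro card_mono) (auto simp: avoiding_triples_def)
  also have "\<dots> = 8 ^ card V"
    using assms by (simp add: card_Pow card_cartesian_product flip: power_mult_distrib)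
  finally show ?thesis .
qed

text \<open>Permuting the coordinates of the relation moves any component to the front, so later
  counts only need conditions on the leading components.\<close>

lemma card_avoiding_triples_swap12:
  "card {(A, B, C) \<in> avoiding_triples V R. P B A C}
    = card {(A, B, C) \<in> avoiding_triples V (\<lambda>x y z. R y x z). P A B C}"
  by (rule bij_betw_same_card [of "\<lambda>(A, B, C). (B, A, C)"],
      rule bij_betw_byWitness [where f' = "\<lambda>(A, B, C). (B, A, C)"])
     (auto simp: avoiding_triples_def avoids_def)

lemma card_avoiding_triples_swap13:
  "card {(A, B, C) \<in> avoiding_triples V R. P C B A}
    = card {(A, B, C) \<in> avoiding_triples V (\<lambda>x y z. R z y x). P A B C}"
  by (rule bij_betw_same_card [of "\<lambda>(A, B, C). (C, B, A)"],
      rule bij_betw_byWitness [where f' = "\<lambda>(A, B, C). (C, B, A)"])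
     (auto simp: avoiding_triples_def avoids_def)

lemma card_avoiding_triples_fst:
  assumes "finite V"
  shows "card {(A, B, C) \<in> avoiding_triples V R. P A}
    = (\<Sum>A | A \<subseteq> V \<and> P A. card (avoiding_pairs V R A))"
proof -
  have "{(A, B, C) \<in> avoiding_triples V R. P A}
      = (SIGMA A:{A. A \<subseteq> V \<and> P A}. avoiding_pairs V R A)"
    by (auto simp: avoiding_triples_def avoiding_pairs_def)
  then show ?thesis
    using assms by (simp add: card_SigmaI finite_avoiding_pairs)
qed

text \<open>Each constraint excludes one of the nine values of the pair \<open>(f y, f (p y))\<close>, and the
  pairs are disjoint.\<close>

lemma card_constrained_functions:
  assumes "finite Y" "finite V" "inj_on p Y" "Y \<inter> p ` Y = {}" "Y \<subseteq> V" "p ` Y \<subseteq> V"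
  shows "9 ^ card Y * card {f \<in> V \<rightarrow>\<^sub>E {0, 1, 2::nat}. \<forall>y\<in>Y. \<not> (f y = 1 \<and> f (p y) = 2)}
    \<le> 8 ^ card Y * 3 ^ card V"
  using assms
proof (induction Y arbitrary: V)
  case empty
  then show ?case by (simp add: card_funcsetE numeral_3_eq_3)
next
  case (insert y Y)
  \<comment> \<open>The constraint at \<open>y\<close> concerns only \<open>y\<close> and
    \<open>p y\<close>. Splitting \<open>f\<close> into its values there and its restriction to
    \<open>W\<close> leaves the same problem for \<open>Y\<close> and \<open>W\<close>, which is why
    the induction generalizes \<open>V\<close>.\<close>
  define W where "W = V - {y, p y}"
  let ?F = "\<lambda>V Y. {f \<in> V \<rightarrow>\<^sub>E {0, 1, 2::nat}. \<forall>y\<in>Y. \<not> (f y = 1 \<and> f (p y) = 2)}"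
  let ?Q = "{0, 1, 2::nat} \<times> {0, 1, 2::nat} - {(1, 2)}"
  have y: "y \<in> V" "p y \<in> V" "y \<noteq> p y"
    using insert.prems by auto
  have sub: "Y \<subseteq> W" "p ` Y \<subseteq> W"
    using insert.prems insert.hyps by (auto simp: W_def inj_on_def)
  have IH: "9 ^ card Y * card (?F W Y) \<le> 8 ^ card Y * 3 ^ card W"
    using insert.prems sub by (intro insert.IH) (auto simp: W_def inj_on_def)
  have V: "V = insert y (insert (p y) W)" "y \<notin> W" "p y \<notin> W" "finite W"
    using y insert.prems by (auto simp: W_def)
  then have cV: "card V = card W + 2"
    using y by simp
  have "card (?F V (insert y Y)) \<le> card (?Q \<times> ?F W Y)"
  proof (rule card_inj_on_le)
    let ?h = "\<lambda>f. ((f y, f (p y)), restrict f W)"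
    show "inj_on ?h (?F V (insert y Y))"
    proof (rule inj_onI)
      fix f g
      assume f: "f \<in> ?F V (insert y Y)" and g: "g \<in> ?F V (insert y Y)" and eq: "?h f = ?h g"
      from f g have "f \<in> V \<rightarrow>\<^sub>E {0, 1, 2}" "g \<in> V \<rightarrow>\<^sub>E {0, 1, 2}"
        by blast+
      then show "f = g"
      proof (rule PiE_ext)
        fix v assume "v \<in> V"
        then consider "v = y" | "v = p y" | "v \<in> W" using V by auto
        then show "f v = g v"
        proof cases
          case 3
          with eq show ?thesis by (metis prod.inject restrict_apply')
        qed (use eq in auto)
      qed
    qed
    show "?h ` ?F V (insert y Y) \<subseteq> ?Q \<times> ?F W Y"
    proof
      fix h assume "h \<in> ?h ` ?F V (insert y Y)"
      then obtain f where f: "f \<in> ?F V (insert y Y)" "h = ?h f" by blast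
      then have "f y \<in> {0, 1, 2}" "f (p y) \<in> {0, 1, 2}" "\<not> (f y = 1 \<and> f (p y) = 2)"
        using y by (auto simp: PiE_def Pi_def)
      moreover have "restrict f W \<in> W \<rightarrow>\<^sub>E {0, 1, 2}"
        using f V by (auto simp: PiE_def Pi_def)
      moreover have "\<forall>v\<in>Y. \<not> (restrict f W v = 1 \<and> restrict f W (p v) = 2)"
        using f sub by auto
      ultimately show "h \<in> ?Q \<times> ?F W Y"
        using f by auto
    qed
    have "finite (?F W Y)"
      using V by (auto intro!: finite_PiE)
    then show "finite (?Q \<times> ?F W Y)"
      by (simp add: finite_cartesian_product)
  qed
  also have "\<dots> = 8 * card (?F W Y)"
    by (simp add: card_cartesian_product)
  finally have "9 ^ card (insert y Y) * card (?F V (insert y Y))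
      \<le> 72 * (9 ^ card Y * card (?F W Y))"
    using insert.hyps by simp
  also have "\<dots> \<le> 72 * (8 ^ card Y * 3 ^ card W)"
    using IH by simp
  also have "\<dots> = 8 ^ card (insert y Y) * 3 ^ card V"
    using insert.hyps cV by simp
  finally show ?case .
qed

text \<open>Take \<open>Y\<close> maximal among the sets disjoint from their image. A point outside
  \<open>Y\<close>, its image and its preimage could be added, because \<open>p\<close> does not fix
  it; so these three sets, none larger than \<open>Y\<close>, cover \<open>V\<close>.\<close>

lemma derangement_independent_third:
  assumes "finite V" "bij_betw p V V" "\<And>y. y \<in> V \<Longrightarrow> p y \<noteq> y"
  obtains Y where "Y \<subseteq> V" "Y \<inter> p ` Y = {}" "card V \<le> 3 * card Y"
proof -
  define \<Y> where "\<Y> = {Y. Y \<subseteq> V \<and> Y \<inter> p ` Y = {}}"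
  have fin: "finite \<Y>"
    using assms(1) by (auto simp: \<Y>_def intro: finite_subset [of _ "Pow V"])
  have "{} \<in> \<Y>" by (simp add: \<Y>_def)
  with fin obtain Y where Y: "Y \<in> \<Y>" and max: "\<And>Z. Z \<in> \<Y> \<Longrightarrow> Y \<subseteq> Z \<Longrightarrow> Z = Y"
    using finite_has_maximal [of \<Y>] by (metis empty_iff)
  have YV: "Y \<subseteq> V" "Y \<inter> p ` Y = {}" using Y by (auto simp: \<Y>_def)
  have finY: "finite Y" using YV assms(1) finite_subset by blast
  let ?X = "{v \<in> V. p v \<in> Y}"
  have inj: "inj_on p V" using assms(2) by (simp add: bij_betw_def)
  have "V \<subseteq> Y \<union> p ` Y \<union> ?X"
  proof
    fix v assume v: "v \<in> V"
    show "v \<in> Y \<union> p ` Y \<union> ?X"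
    proof (rule ccontr)
      assume *: "v \<notin> Y \<union> p ` Y \<union> ?X"
      then have "insert v Y \<in> \<Y>"
        using v YV assms(3) [OF v] by (auto simp: \<Y>_def)
      from max [OF this] * show False by auto
    qed
  qed
  then have "card V \<le> card (Y \<union> p ` Y \<union> ?X)"
    using assms(1) finY by (intro card_mono) auto
  also have "\<dots> \<le> card Y + card (p ` Y) + card ?X"
    by (meson add_mono_thms_linordered_semiring(3) card_Un_le le_trans)
  also have "card (p ` Y) \<le> card Y" using finY by (rule card_image_le)
  also have "card ?X \<le> card Y"
    using inj finY by (intro card_inj_on_le [of p]) (auto simp: inj_on_def)
  finally have "card V \<le> 3 * card Y" by simp
  with YV show thesis using that by blast
qed

text \<open>A ternary relation instead of a binary operation puts the three coordinates on an equal
  footing: permuting them gives a Latin square on \<open>V\<close> again.\<close>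

locale latin_square =
  fixes V :: "'a set" and R :: "'a \<Rightarrow> 'a \<Rightarrow> 'a \<Rightarrow> bool"
  assumes finite_V: "finite V"
    and ex1_z: "x \<in> V \<Longrightarrow> y \<in> V \<Longrightarrow> \<exists>!z. z \<in> V \<and> R x y z"
    and ex1_y: "x \<in> V \<Longrightarrow> z \<in> V \<Longrightarrow> \<exists>!y. y \<in> V \<and> R x y z"
    and ex1_x: "y \<in> V \<Longrightarrow> z \<in> V \<Longrightarrow> \<exists>!x. x \<in> V \<and> R x y z"
begin

lemma swap12: "latin_square V (\<lambda>x y z. R y x z)"
  by unfold_locales (simp_all add: finite_V ex1_x ex1_y ex1_z)

lemma swap13: "latin_square V (\<lambda>x y z. R z y x)"
  by unfold_locales (simp_all add: finite_V ex1_x ex1_y ex1_z)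

lemma finite_sub: "A \<subseteq> V \<Longrightarrow> finite A"
  using finite_V finite_subset by blast

lemma card_sub: "A \<subseteq> V \<Longrightarrow> card A \<le> card V"
  using finite_V by (rule card_mono)

definition third :: "'a \<Rightarrow> 'a \<Rightarrow> 'a" where
  "third x y = (THE z. z \<in> V \<and> R x y z)"

lemma third: "x \<in> V \<Longrightarrow> y \<in> V \<Longrightarrow> third x y \<in> V \<and> R x y (third x y)"
  unfolding third_def by (rule theI') (rule ex1_z)

lemma R_iff: "x \<in> V \<Longrightarrow> y \<in> V \<Longrightarrow> z \<in> V \<Longrightarrow> R x y z \<longleftrightarrow> z = third x y"
  using third ex1_z by blast

lemma bij_third:
  assumes "x \<in> V"
  shows "bij_betw (third x) V V"
  unfolding bij_betw_def
proof
  show inj: "inj_on (third x) V"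
    using assms third ex1_y by (intro inj_onI) metis
  show "third x ` V = V"
    using assms third inj finite_V by (intro endo_inj_surj) auto
qed

text \<open>A pair avoiding \<open>x\<close> is a colouring of \<open>V\<close>: colour 1 for \<open>B\<close>, colour 2 for the preimage
  of \<open>C\<close> under \<open>third x\<close>.\<close>

definition decode :: "'a \<Rightarrow> ('a \<Rightarrow> nat) \<Rightarrow> 'a set \<times> 'a set" where
  "decode x f = ({y \<in> V. f y = 1}, third x ` {y \<in> V. f y = 2})"

text \<open>Avoidance for the single row \<open>x\<close> says exactly that \<open>B\<close> is
  disjoint from the preimage of \<open>C\<close> under \<open>third x\<close>. Hence colours 1 and 2
  never compete for a point, and colour 0 marks the points in neither set.\<close>

lemma bij_decode:
  assumes x: "x \<in> V"
  shows "bij_betw (decode x) (V \<rightarrow>\<^sub>E {0, 1, 2}) (avoiding_pairs V R {x})"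
proof (rule bij_betw_byWitness
    [where f' = "\<lambda>(B, C). \<lambda>y\<in>V. if y \<in> B then 1 else if third x y \<in> C then 2 else 0"])
  have inj: "inj_on (third x) V" using bij_third [OF x] by (simp add: bij_betw_def)
  have im: "third x ` V = V" using bij_third [OF x] by (simp add: bij_betw_def)
  show "\<forall>f\<in>V \<rightarrow>\<^sub>E {0, 1, 2}. (case decode x f of (B, C) \<Rightarrow>
      \<lambda>y\<in>V. if y \<in> B then 1 else if third x y \<in> C then 2 else 0) = f"
  proof
    fix f assume f: "f \<in> V \<rightarrow>\<^sub>E {0, 1, 2::nat}"
    have "third x y \<in> third x ` {y \<in> V. f y = 2} \<longleftrightarrow> f y = 2" if "y \<in> V" for y
      using inj that by (auto simp: inj_on_def)
    with f show "(case decode x f of (B, C) \<Rightarrow>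
      \<lambda>y\<in>V. if y \<in> B then 1 else if third x y \<in> C then 2 else 0) = f"
      by (auto simp: decode_def fun_eq_iff PiE_def Pi_def extensional_def)
  qed
  show "\<forall>P\<in>avoiding_pairs V R {x}. decode x (case P of (B, C) \<Rightarrow>
      \<lambda>y\<in>V. if y \<in> B then 1 else if third x y \<in> C then 2 else 0) = P"
  proof clarify
    fix B C assume BC: "(B, C) \<in> avoiding_pairs V R {x}"
    let ?f = "\<lambda>y\<in>V. if y \<in> B then 1 else if third x y \<in> C then 2 else 0 :: nat"
    have sub: "B \<subseteq> V" "C \<subseteq> V"
      using BC by (auto simp: avoiding_pairs_def)
    have av: "third x y \<notin> C" if "y \<in> B" for y
      using BC third [OF x, of y] that by (auto simp: avoiding_pairs_def avoids_def)
    have "{y \<in> V. ?f y = 1} = B" using sub by auto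
    moreover have "{y \<in> V. ?f y = 2} = {y \<in> V. third x y \<in> C}" using av by auto
    moreover have "third x ` {y \<in> V. third x y \<in> C} = C" using sub im by auto
    ultimately show "decode x ?f = (B, C)" by (simp only: decode_def)
  qed
  show "decode x ` (V \<rightarrow>\<^sub>E {0, 1, 2}) \<subseteq> avoiding_pairs V R {x}"
  proof
    fix P assume "P \<in> decode x ` (V \<rightarrow>\<^sub>E {0, 1, 2})"
    then obtain f where P: "P = decode x f" by blast
    have "\<not> R x y (third x y')" if "y \<in> V" "y' \<in> V" "f y = 1" "f y' = 2" for y y'
    proof
      assume "R x y (third x y')"
      then have "third x y' = third x y" using that x third by (auto simp: R_iff)
      then show False using inj that by (auto simp: inj_on_def)
    qed
    then show "P \<in> avoiding_pairs V R {x}"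
      using x third by (auto simp: P decode_def avoiding_pairs_def avoids_def)
  qed
  show "(\<lambda>(B, C). \<lambda>y\<in>V. if y \<in> B then 1 else if third x y \<in> C then 2 else 0)
      ` avoiding_pairs V R {x} \<subseteq> V \<rightarrow>\<^sub>E {0, 1, 2}"
    by auto
qed

lemma card_avoiding_pairs_singleton: "x \<in> V \<Longrightarrow> card (avoiding_pairs V R {x}) = 3 ^ card V"
  using bij_betw_same_card [OF bij_decode] finite_V by (simp add: card_funcsetE numeral_3_eq_3)

text \<open>In the colouring attached to \<open>x\<close>, a second row \<open>x'\<close> forbids
  \<open>f y = 1\<close> together with \<open>f (p y) = 2\<close>, where \<open>p\<close> is
  \<open>third x'\<close> followed by the inverse of \<open>third x\<close>. Distinct rows of a
  Latin square agree in no column, so \<open>p\<close> is a derangement and at least a third of the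
  points yield disjoint constraints.\<close>

lemma card_avoiding_pairs_le:
  assumes A: "A \<subseteq> V" "card A \<ge> 2"
  shows "real (card (avoiding_pairs V R A)) \<le> (29/10) ^ card V"
proof -
  let ?d = "card V"
  obtain x x' where x: "x \<in> A" "x' \<in> A" "x \<noteq> x'"
    using A(2) by (meson card_2_iff' obtain_subset_with_card_n subset_iff)
  then have xV: "x \<in> V" "x' \<in> V" using A by auto
  define p where "p = (\<lambda>y. inv_into V (third x) (third x' y))"
  have p: "p y \<in> V" "third x (p y) = third x' y" if "y \<in> V" for y
    using bij_third [OF xV(1)] third [OF xV(2) that]
    by (auto simp: p_def bij_betw_def inv_into_into f_inv_into_f)
  have bij: "bij_betw p V V"
    using bij_betw_trans [OF bij_third [OF xV(2)] bij_betw_inv_into [OF bij_third [OF xV(1)]]]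
    by (simp add: p_def comp_def)
  have "p y \<noteq> y" if "y \<in> V" for y
  proof
    assume "p y = y"
    then have "third x y = third x' y" using p that by metis
    then show False using x xV that third ex1_x by metis
  qed
  then obtain Y where Y: "Y \<subseteq> V" "Y \<inter> p ` Y = {}" "?d \<le> 3 * card Y"
    using derangement_independent_third [OF finite_V bij] by metis
  let ?F = "{f \<in> V \<rightarrow>\<^sub>E {0, 1, 2::nat}. \<forall>y\<in>Y. \<not> (f y = 1 \<and> f (p y) = 2)}"
  have finF: "finite ?F"
    using finite_V by (auto intro!: finite_PiE)
  have "avoiding_pairs V R A \<subseteq> decode x ` ?F"
  proof
    fix P assume P: "P \<in> avoiding_pairs V R A"
    then have "P \<in> avoiding_pairs V R {x}"
      using avoiding_pairs_anti_mono [of "{x}" A V R] x by auto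
    then obtain f where f: "f \<in> V \<rightarrow>\<^sub>E {0, 1, 2}" "P = decode x f"
      using bij_decode [OF xV(1)] by (auto simp: bij_betw_def)
    have "\<not> (f y = 1 \<and> f (p y) = 2)" if "y \<in> Y" for y
    proof
      assume *: "f y = 1 \<and> f (p y) = 2"
      have yV: "y \<in> V" using that Y by auto
      have "third x (p y) \<in> third x ` {y \<in> V. f y = 2}"
        using * p(1) [OF yV] by (intro imageI) simp
      then have "third x' y \<in> third x ` {y \<in> V. f y = 2}"
        by (simp only: p(2) [OF yV])
      moreover have "R x' y (third x' y)" using third xV yV by blast
      ultimately show False
        using P x yV * by (auto simp: f(2) decode_def avoiding_pairs_def avoids_def)
    qed
    with f show "P \<in> decode x ` ?F" by blast
  qed
  then have "card (avoiding_pairs V R A) \<le> card ?F"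
    using finF by (meson card_image_le card_mono finite_imageI le_trans)
  then have "9 ^ card Y * card (avoiding_pairs V R A) \<le> 9 ^ card Y * card ?F"
    by simp
  also have "\<dots> \<le> 8 ^ card Y * 3 ^ ?d"
  proof (rule card_constrained_functions)
    show "inj_on p Y"
      using bij Y by (meson bij_betw_def inj_on_subset)
    show "p ` Y \<subseteq> V"
      using bij Y by (auto simp: bij_betw_def)
  qed (use Y finite_V finite_sub in auto)
  finally have "real (9 ^ card Y * card (avoiding_pairs V R A)) \<le> real (8 ^ card Y * 3 ^ ?d)"
    by (rule of_nat_mono)
  then have "real (card (avoiding_pairs V R A)) \<le> (8/9) ^ card Y * 3 ^ ?d"
    by (simp add: power_divide field_simps)
  \<comment> \<open>Since \<open>8/9 \<le> (29/30) ^ 3\<close> and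
    \<open>card V \<le> 3 * card Y\<close>, a factor 8/9 per constraint becomes a factor 29/30 per
    point, and \<open>3 * 29/30 = 29/10\<close>.\<close>
  also have "(8/9 :: real) ^ card Y \<le> ((29/30) ^ 3) ^ card Y"
    by (intro power_mono) (auto simp: power3_eq_cube)
  also have "\<dots> = (29/30) ^ (3 * card Y)" by (simp add: power_mult)
  also have "\<dots> \<le> (29/30) ^ ?d" using Y by (intro power_decreasing) auto
  also have "(29/30) ^ ?d * 3 ^ ?d = (29/10 :: real) ^ ?d"
    by (simp flip: power_mult_distrib)
  finally show ?thesis by simp
qed

section \<open>Triples whose first component is small\<close>

lemma subsets_card_le_1: "{A. A \<subseteq> V \<and> card A \<le> 1} = insert {} ((\<lambda>x. {x}) ` V)"
proof (intro equalityI subsetI)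
  fix A assume "A \<in> {A. A \<subseteq> V \<and> card A \<le> 1}"
  then have A: "A \<subseteq> V" "card A \<le> 1" "finite A" using finite_sub by auto
  then have "card A = 0 \<or> card A = 1" by linarith
  then show "A \<in> insert {} ((\<lambda>x. {x}) ` V)"
    using A by (auto simp: card_1_singleton_iff)
qed auto

text \<open>The empty set constrains nothing and leaves \<open>4 ^ card V\<close> pairs; each
  singleton leaves \<open>3 ^ card V\<close>, one for every colouring.\<close>

lemma card_fst_le_1:
  "card {(A, B, C) \<in> avoiding_triples V R. card A \<le> 1} = 4 ^ card V + card V * 3 ^ card V"
proof -
  have "avoiding_pairs V R {} = Pow V \<times> Pow V"
    by (auto simp: avoiding_pairs_def avoids_def)
  then have "card (avoiding_pairs V R {}) = 4 ^ card V"
    using finite_V by (simp add: card_Pow card_cartesian_product flip: power_mult_distrib)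
  moreover have "(\<Sum>A\<in>(\<lambda>x. {x}) ` V. card (avoiding_pairs V R A)) = card V * 3 ^ card V"
    by (simp add: sum.reindex card_avoiding_pairs_singleton)
  ultimately show ?thesis
    unfolding card_avoiding_triples_fst [OF finite_V] subsets_card_le_1
    using finite_V by (subst sum.insert) auto
qed

lemma card_fst_small_le:
  "real (card {(A, B, C) \<in> avoiding_triples V R. 2 \<le> card A \<and> real (card A) \<le> m})
    \<le> card (small_subsets V m) * (29/10) ^ card V"
proof -
  let ?S = "{A. A \<subseteq> V \<and> 2 \<le> card A \<and> real (card A) \<le> m}"
  have "real (card {(A, B, C) \<in> avoiding_triples V R. 2 \<le> card A \<and> real (card A) \<le> m})
      = (\<Sum>A\<in>?S. real (card (avoiding_pairs V R A)))"
    by (simp add: card_avoiding_triples_fst [OF finite_V])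
  also have "\<dots> \<le> (\<Sum>A\<in>?S. (29/10) ^ card V)"
    by (intro sum_mono card_avoiding_pairs_le) auto
  also have "\<dots> = card ?S * (29/10) ^ card V" by simp
  also have "\<dots> \<le> card (small_subsets V m) * (29/10) ^ card V"
    using finite_small_subsets [OF finite_V]
    by (intro mult_right_mono of_nat_mono card_mono) (auto simp: small_subsets_def)
  finally show ?thesis .
qed

end

section \<open>Containers\<close>

text \<open>With a singleton in one place, \<open>card (edges R {x} B C)\<close> serves as the
  degree of \<open>x\<close> into \<open>B\<close> and \<open>C\<close>.\<close>

definition edges :: "('a \<Rightarrow> 'a \<Rightarrow> 'a \<Rightarrow> bool) \<Rightarrow> 'a set \<Rightarrow> 'a set \<Rightarrow> 'a set \<Rightarrow> ('a \<times> 'a \<times> 'a) set" where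
  "edges R A B C = {(x, y, z). x \<in> A \<and> y \<in> B \<and> z \<in> C \<and> R x y z}"

lemma finite_edges: "finite A \<Longrightarrow> finite B \<Longrightarrow> finite C \<Longrightarrow> finite (edges R A B C)"
  by (rule finite_subset [of _ "A \<times> B \<times> C"]) (auto simp: edges_def)

lemma card_edges_sum_fst:
  assumes "finite A" "finite B" "finite C"
  shows "card (edges R A B C) = (\<Sum>x\<in>A. card (edges R {x} B C))"
proof -
  have "edges R A B C = (\<Union>x\<in>A. edges R {x} B C)" by (auto simp: edges_def)
  also have "card \<dots> = (\<Sum>x\<in>A. card (edges R {x} B C))"
    using assms by (intro card_UN_disjoint ballI impI finite_edges) (auto simp: edges_def)
  finally show ?thesis .
qed

lemma card_edges_sum_snd:
  assumes "finite A" "finite B" "finite C"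
  shows "card (edges R A B C) = (\<Sum>y\<in>B. card (edges R A {y} C))"
proof -
  have "edges R A B C = (\<Union>y\<in>B. edges R A {y} C)" by (auto simp: edges_def)
  also have "card \<dots> = (\<Sum>y\<in>B. card (edges R A {y} C))"
    using assms by (intro card_UN_disjoint ballI impI finite_edges) (auto simp: edges_def)
  finally show ?thesis .
qed

lemma card_edges_swap12: "card (edges (\<lambda>x y z. R y x z) A B C) = card (edges R B A C)"
  by (rule bij_betw_same_card [of "\<lambda>(x, y, z). (y, x, z)"],
      rule bij_betw_byWitness [where f' = "\<lambda>(x, y, z). (y, x, z)"]) (auto simp: edges_def)

lemma card_edges_swap13: "card (edges (\<lambda>x y z. R z y x) A B C) = card (edges R C B A)"
  by (rule bij_betw_same_card [of "\<lambda>(x, y, z). (z, y, x)"],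
      rule bij_betw_byWitness [where f' = "\<lambda>(x, y, z). (z, y, x)"]) (auto simp: edges_def)

section \<open>Edge counts in a Latin square\<close>

context latin_square
begin

text \<open>Two coordinates of an edge determine the third. For a one-element first set this bounds
  the degree of a vertex by \<open>card B\<close>.\<close>

lemma card_edges_le_12:
  assumes "A \<subseteq> V" "B \<subseteq> V" "C \<subseteq> V"
  shows "card (edges R A B C) \<le> card A * card B"
proof -
  have "card (edges R A B C) \<le> card (A \<times> B)"
  proof (rule card_inj_on_le)
    show "inj_on (\<lambda>(x, y, z). (x, y)) (edges R A B C)"
    proof (rule inj_onI, clarsimp simp: edges_def)
      fix x y z z' assume "x \<in> A" "y \<in> B" "z \<in> C" "z' \<in> C" "R x y z" "R x y z'"
      then show "z = z'" using ex1_z [of x y] assms by blast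
    qed
    show "(\<lambda>(x, y, z). (x, y)) ` edges R A B C \<subseteq> A \<times> B"
      by (auto simp: edges_def)
    show "finite (A \<times> B)" using assms by (simp add: finite_sub)
  qed
  then show ?thesis by (simp add: card_cartesian_product)
qed

lemma card_edges_le_13:
  assumes "A \<subseteq> V" "B \<subseteq> V" "C \<subseteq> V"
  shows "card (edges R A B C) \<le> card A * card C"
proof -
  have "card (edges R A B C) \<le> card (A \<times> C)"
  proof (rule card_inj_on_le)
    show "inj_on (\<lambda>(x, y, z). (x, z)) (edges R A B C)"
    proof (rule inj_onI, clarsimp simp: edges_def)
      fix x y y' z assume "x \<in> A" "y \<in> B" "y' \<in> B" "z \<in> C" "R x y z" "R x y' z"
      then show "y = y'" using ex1_y [of x z] assms by blast
    qed
    show "(\<lambda>(x, y, z). (x, z)) ` edges R A B C \<subseteq> A \<times> C"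
      by (auto simp: edges_def)
    show "finite (A \<times> C)" using assms by (simp add: finite_sub)
  qed
  then show ?thesis by (simp add: card_cartesian_product)
qed

text \<open>For each \<open>x\<close>, the \<open>card B\<close> values \<open>third x y\<close>
  with \<open>y\<close> in \<open>B\<close> must overlap \<open>C\<close> inside \<open>V\<close>,
  and each common point ends an edge at \<open>x\<close>. Over the reals the difference may be
  negative without truncation.\<close>

lemma card_edges_ge:
  assumes "A \<subseteq> V" "B \<subseteq> V" "C \<subseteq> V"
  shows "real (card A) * (real (card B) + card C - card V) \<le> card (edges R A B C)"
proof -
  have "real (card B) + card C - card V \<le> card (edges R {x} B C)" if x: "x \<in> A" for x
  proof -
    have xV: "x \<in> V" using x assms by auto
    have inj: "inj_on (third x) B"
      using bij_third [OF xV] assms by (meson bij_betw_def inj_on_subset)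
    have sub: "third x ` B \<subseteq> V"
      using third [OF xV] assms by auto
    have "card (third x ` B) + card C = card (third x ` B \<union> C) + card (third x ` B \<inter> C)"
      using assms by (intro card_Un_Int) (auto simp: finite_sub)
    moreover have "card (third x ` B \<union> C) \<le> card V"
      using sub assms by (intro card_sub) auto
    moreover have "card (third x ` B \<inter> C) \<le> card (edges R {x} B C)"
    proof (rule surj_card_le)
      show "finite (edges R {x} B C)"
        using assms by (intro finite_edges) (auto simp: finite_sub)
      show "third x ` B \<inter> C \<subseteq> (\<lambda>(x, y, z). z) ` edges R {x} B C"
      proof
        fix z assume "z \<in> third x ` B \<inter> C"
        then obtain y where y: "y \<in> B" "z = third x y" "z \<in> C" by blast
        then have "(x, y, z) \<in> edges R {x} B C"
          using third [OF xV, of y] assms by (auto simp: edges_def)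
        then show "z \<in> (\<lambda>(x, y, z). z) ` edges R {x} B C" by (rule rev_image_eqI) simp
      qed
    qed
    ultimately show ?thesis
      using card_image [OF inj] by linarith
  qed
  then have "(\<Sum>x\<in>A. real (card B) + card C - card V) \<le> (\<Sum>x\<in>A. real (card (edges R {x} B C)))"
    by (rule sum_mono)
  also have "\<dots> = card (edges R A B C)"
    using assms by (subst card_edges_sum_fst) (auto simp: finite_sub)
  finally show ?thesis by simp
qed

text \<open>If \<open>card B + card C\<close> exceeded \<open>card V\<close> by more than
  \<open>\<theta> * card V\<close>, each of the at least \<open>\<epsilon> * card V\<close> elements
  of \<open>A\<close> would lie in more than \<open>\<theta> * card V\<close> edges, too many in
  total.\<close>

lemma pair_size_le:
  fixes \<theta> \<epsilon> :: real
  assumes "A \<subseteq> V" "B \<subseteq> V" "C \<subseteq> V"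
    and e: "real (card (edges R A B C)) < \<theta> * \<epsilon> * (card V)\<^sup>2"
    and A: "\<epsilon> * card V \<le> card A" and \<theta>: "\<theta> \<ge> 0"
  shows "real (card B) + card C \<le> (1 + \<theta>) * card V"
proof (rule ccontr)
  assume "\<not> ?thesis"
  then have *: "\<theta> * card V \<le> real (card B) + card C - card V" by (simp add: algebra_simps)
  have "\<theta> * \<epsilon> * (card V)\<^sup>2 = (\<epsilon> * card V) * (\<theta> * card V)"
    by (simp add: power2_eq_square)
  also have "\<dots> \<le> card A * (real (card B) + card C - card V)"
    using A * \<theta> by (intro mult_mono) auto
  also have "\<dots> \<le> card (edges R A B C)"
    using assms by (intro card_edges_ge)
  finally show False using e by simp
qed

text \<open>Each pair of components is bounded after a suitable coordinate swap; the three bounds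
  add up to twice the total size.\<close>

lemma total_size_le:
  fixes \<theta> \<epsilon> :: real
  assumes "A \<subseteq> V" "B \<subseteq> V" "C \<subseteq> V"
    and "real (card (edges R A B C)) < \<theta> * \<epsilon> * (card V)\<^sup>2"
    and "\<epsilon> * card V \<le> card A" "\<epsilon> * card V \<le> card B" "\<epsilon> * card V \<le> card C" and "\<theta> \<ge> 0"
  shows "2 * (real (card A) + card B + card C) \<le> 3 * (1 + \<theta>) * card V"
proof -
  have "real (card B) + card C \<le> (1 + \<theta>) * card V"
    using assms by (intro pair_size_le)
  moreover have "real (card A) + card C \<le> (1 + \<theta>) * card V"
    using assms card_edges_swap12 [of R B A C]
    by (intro latin_square.pair_size_le [OF swap12, of B A C]) simp_all
  moreover have "real (card B) + card A \<le> (1 + \<theta>) * card V"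
    using assms card_edges_swap13 [of R C B A]
    by (intro latin_square.pair_size_le [OF swap13, of C B A]) simp_all
  ultimately show ?thesis by (simp add: algebra_simps)
qed

text \<open>Every \<open>C\<close> with \<open>avoids R S T C\<close> is disjoint from this set, so
  a fingerprint \<open>(S, T)\<close> determines points that may be deleted from the
  container.\<close>

definition nbhd :: "'a set \<Rightarrow> 'a set \<Rightarrow> 'a set" where
  "nbhd S T = {z \<in> V. \<exists>x\<in>S. \<exists>y\<in>T. R x y z}"

text \<open>A maximal subset \<open>T\<close> of \<open>B\<^sub>0\<close> for which every element contributes at least \<open>k\<close> fresh
  neighbours in \<open>C\<close>.\<close>

lemma greedy_fingerprint:
  fixes k :: real
  assumes sub: "S \<subseteq> V" "B\<^sub>0 \<subseteq> V" "C \<subseteq> V" and k: "k > 0"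
  obtains T where "T \<subseteq> B\<^sub>0" "card T * k \<le> card V"
    "\<And>y. y \<in> B\<^sub>0 \<Longrightarrow> card (edges R S {y} (C - nbhd S T)) < k"
proof -
  define \<T> where "\<T> = {T. T \<subseteq> B\<^sub>0 \<and> card T * k \<le> card (C \<inter> nbhd S T)}"
  have "finite \<T>"
    using finite_sub [OF sub(2)] by (auto simp: \<T>_def intro: finite_subset [of _ "Pow B\<^sub>0"])
  moreover have "{} \<in> \<T>" by (simp add: \<T>_def)
  ultimately obtain T where T: "T \<in> \<T>" and max: "\<And>Z. Z \<in> \<T> \<Longrightarrow> T \<subseteq> Z \<Longrightarrow> Z = T"
    using finite_has_maximal [of \<T>] by (metis empty_iff)
  have TB: "T \<subseteq> B\<^sub>0" and Tk: "card T * k \<le> card (C \<inter> nbhd S T)"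
    using T by (auto simp: \<T>_def)
  show thesis
  proof (rule that)
    show "T \<subseteq> B\<^sub>0" by (fact TB)
    have "card (C \<inter> nbhd S T) \<le> card V" by (rule card_sub) (use sub in auto)
    with Tk show "card T * k \<le> card V" by linarith
    fix y assume y: "y \<in> B\<^sub>0"
    let ?E = "edges R S {y} (C - nbhd S T)"
    show "card ?E < k"
    proof (rule ccontr)
      assume "\<not> card ?E < k"
      then have ge: "card ?E \<ge> k" by simp
      then have "?E \<noteq> {}" using k by auto
      then have yT: "y \<notin> T" using sub by (auto simp: edges_def nbhd_def)
      have fin: "finite C" "finite T" using sub TB finite_sub by (blast, blast)
      have yV: "y \<in> V" using y sub by auto
      \<comment> \<open>For fixed \<open>y\<close>, the value \<open>z\<close> determines
        \<open>x\<close>, so the edges at \<open>y\<close> count distinct fresh neighbours and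
        \<open>T\<close> could be enlarged by \<open>y\<close>.\<close>
      have "card ?E \<le> card (C \<inter> nbhd S {y} - nbhd S T)"
      proof (rule card_inj_on_le)
        show "inj_on (\<lambda>(x, y, z). z) ?E"
        proof (rule inj_onI, clarsimp simp: edges_def)
          fix x x' z assume "x \<in> S" "x' \<in> S" "z \<in> C" "R x y z" "R x' y z"
          then show "x = x'" using ex1_x [OF yV, of z] sub by blast
        qed
        show "(\<lambda>(x, y, z). z) ` ?E \<subseteq> C \<inter> nbhd S {y} - nbhd S T"
          using sub by (auto simp: edges_def nbhd_def)
      qed (use fin in auto)
      moreover have "C \<inter> nbhd S (insert y T)
          = (C \<inter> nbhd S T) \<union> (C \<inter> nbhd S {y} - nbhd S T)"
        by (auto simp: nbhd_def)
      then have "card (C \<inter> nbhd S (insert y T))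
          = card (C \<inter> nbhd S T) + card (C \<inter> nbhd S {y} - nbhd S T)"
        using fin by (simp add: card_Un_disjoint disjoint_iff)
      ultimately have "card (insert y T) * k \<le> card (C \<inter> nbhd S (insert y T))"
        using Tk ge yT fin by (simp add: algebra_simps)
      then have "insert y T \<in> \<T>" using y TB by (auto simp: \<T>_def)
      from max [OF this] yT show False by auto
    qed
  qed
qed

text \<open>At least \<open>s * (\<delta> / 2 * card V)\<close> edges join \<open>S\<close> to
  \<open>B\<close> and \<open>C\<close>, and at most half that number survive in \<open>B'\<close>
  and \<open>C'\<close>. Every other edge uses a deleted vertex, and a deleted vertex lies in at
  most \<open>s\<close> of them; so at least \<open>\<delta> / 4 * card V\<close> vertices are
  deleted.\<close>

lemma container_shrinks:
  fixes \<delta> :: real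
  assumes sub: "S \<subseteq> V" "B \<subseteq> V" "C \<subseteq> V"
    and S: "card S = s" "s > 0"
    and deg: "\<And>x. x \<in> S \<Longrightarrow> \<delta> / 2 * card V \<le> card (edges R {x} B C)"
    and sub': "B' \<subseteq> B" "C' \<subseteq> C"
    and low: "\<And>y. y \<in> B' \<Longrightarrow> card (edges R S {y} C') \<le> \<delta> * s / 4" and "\<delta> \<ge> 0"
  shows "real (card B') + card C' \<le> real (card B) + card C - \<delta> / 4 * card V"
proof -
  have fin: "finite S" "finite B" "finite C" "finite B'" "finite C'"
    using sub sub' by (auto intro: finite_sub finite_subset)
  have "s * (\<delta> / 2 * card V) = (\<Sum>x\<in>S. \<delta> / 2 * card V)" using S by simp
  also have "\<dots> \<le> (\<Sum>x\<in>S. real (card (edges R {x} B C)))" by (rule sum_mono) (rule deg)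
  also have "\<dots> = card (edges R S B C)" using fin by (subst card_edges_sum_fst) auto
  also have "card (edges R S B C)
      \<le> card (edges R S B' C' \<union> edges R S (B - B') C \<union> edges R S B (C - C'))"
    using fin by (intro card_mono finite_UnI finite_edges) (auto simp: edges_def)
  also have "\<dots> \<le> card (edges R S B' C') + card (edges R S (B - B') C) + card (edges R S B (C - C'))"
    by (meson add_mono_thms_linordered_semiring(3) card_Un_le le_trans)
  also have "card (edges R S (B - B') C) \<le> s * card (B - B')"
    unfolding S(1)[symmetric] using sub by (intro card_edges_le_12) auto
  also have "card (edges R S B (C - C')) \<le> s * card (C - C')"
    unfolding S(1)[symmetric] using sub by (intro card_edges_le_13) auto
  finally have 1: "s * (\<delta> / 2 * card V)
      \<le> card (edges R S B' C') + s * (real (card (B - B')) + card (C - C'))"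
    by (simp add: algebra_simps)
  have "real (card (edges R S B' C')) = (\<Sum>y\<in>B'. real (card (edges R S {y} C')))"
    using fin by (subst card_edges_sum_snd) auto
  also have "\<dots> \<le> (\<Sum>y\<in>B'. \<delta> * s / 4)" by (rule sum_mono) (rule low)
  also have "\<dots> = card B' * (\<delta> * s / 4)" by simp
  also have "\<dots> \<le> card V * (\<delta> * s / 4)"
    using sub sub' \<open>\<delta> \<ge> 0\<close> by (intro mult_right_mono of_nat_mono card_sub) auto
  finally have "s * (\<delta> / 2 * card V)
      \<le> s * (\<delta> / 4 * card V + (real (card (B - B')) + card (C - C')))"
    using 1 by (simp add: algebra_simps)
  then have "\<delta> / 2 * card V \<le> \<delta> / 4 * card V + (real (card (B - B')) + card (C - C'))"
    using S by simp
  moreover have "card B = card B' + card (B - B')" "card C = card C' + card (C - C')"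
    using fin sub' by (simp_all add: card_Diff_subset card_mono)
  ultimately show ?thesis by simp
qed

definition high_degree :: "real \<Rightarrow> 'a set \<Rightarrow> 'a set \<Rightarrow> 'a set \<Rightarrow> 'a set" where
  "high_degree \<delta> A B C = {x \<in> A. \<delta> / 2 * card V \<le> card (edges R {x} B C)}"

text \<open>Vertices below the threshold account for at most half of the
  \<open>\<delta> * (card V)\<^sup>2\<close> edges, and no vertex has degree above
  \<open>card V\<close>, so the other half needs many vertices above the threshold.\<close>

lemma card_high_degree_ge:
  fixes \<delta> :: real
  assumes sub: "A \<subseteq> V" "B \<subseteq> V" "C \<subseteq> V" and V: "V \<noteq> {}" and "\<delta> \<ge> 0"
    and e: "\<delta> * (card V)\<^sup>2 \<le> card (edges R A B C)"
  shows "\<delta> / 2 * card V \<le> card (high_degree \<delta> A B C)"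
proof -
  let ?d = "real (card V)" and ?H = "high_degree \<delta> A B C"
  have d: "?d > 0" using V finite_V by (simp add: card_gt_0_iff)
  have fin: "finite A" "finite B" "finite C" "finite ?H"
    using sub by (auto simp: high_degree_def finite_sub)
  have HA: "?H \<subseteq> A" by (auto simp: high_degree_def)
  have "\<delta> * ?d\<^sup>2 \<le> (\<Sum>x\<in>A. real (card (edges R {x} B C)))"
    using e fin by (subst (asm) card_edges_sum_fst) auto
  also have "\<dots> = (\<Sum>x\<in>A - ?H. real (card (edges R {x} B C))) + (\<Sum>x\<in>?H. real (card (edges R {x} B C)))"
    using HA fin(1) by (rule sum.subset_diff)
  also have "(\<Sum>x\<in>A - ?H. real (card (edges R {x} B C))) \<le> (\<Sum>x\<in>A - ?H. \<delta> / 2 * ?d)"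
    by (rule sum_mono) (auto simp: high_degree_def)
  also have "\<dots> \<le> ?d * (\<delta> / 2 * ?d)"
    using sub \<open>\<delta> \<ge> 0\<close>
    by (auto simp: sum_constant simp del: times_divide_eq_left times_divide_eq_right
        intro!: mult_right_mono card_sub)
  also have "(\<Sum>x\<in>?H. real (card (edges R {x} B C))) \<le> (\<Sum>x\<in>?H. ?d)"
  proof (rule sum_mono)
    fix x assume "x \<in> ?H"
    then have "card (edges R {x} B C) \<le> card {x} * card B"
      using HA sub by (intro card_edges_le_12) auto
    with card_sub [OF sub(2)] show "real (card (edges R {x} B C)) \<le> ?d" by simp
  qed
  finally have "?d * (\<delta> / 2 * ?d) \<le> ?d * card ?H"
    by (simp add: power2_eq_square algebra_simps)
  with d show ?thesis by simp
qed

definition covers :: "('a set \<times> 'a set \<times> 'a set) set \<Rightarrow> 'a set \<Rightarrow> 'a set \<Rightarrow> 'a set \<Rightarrow> bool" where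
  "covers F A B C \<longleftrightarrow> (\<forall>A\<^sub>0 B\<^sub>0 C\<^sub>0. A\<^sub>0 \<subseteq> A \<longrightarrow> B\<^sub>0 \<subseteq> B \<longrightarrow> C\<^sub>0 \<subseteq> C \<longrightarrow> avoids R A\<^sub>0 B\<^sub>0 C\<^sub>0 \<longrightarrow>
     (\<exists>(A', B', C')\<in>F. A\<^sub>0 \<subseteq> A' \<and> B\<^sub>0 \<subseteq> B' \<and> C\<^sub>0 \<subseteq> C'))"

lemma coversD:
  assumes "covers F A B C" "A\<^sub>0 \<subseteq> A" "B\<^sub>0 \<subseteq> B" "C\<^sub>0 \<subseteq> C" "avoids R A\<^sub>0 B\<^sub>0 C\<^sub>0"
  obtains A' B' C' where "(A', B', C') \<in> F" "A\<^sub>0 \<subseteq> A'" "B\<^sub>0 \<subseteq> B'" "C\<^sub>0 \<subseteq> C'"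
proof -
  have "\<exists>(A', B', C')\<in>F. A\<^sub>0 \<subseteq> A' \<and> B\<^sub>0 \<subseteq> B' \<and> C\<^sub>0 \<subseteq> C'"
    using assms by (simp add: covers_def)
  then show thesis using that by auto
qed

lemma covers_refl: "covers {(A, B, C)} A B C"
  by (simp add: covers_def)

lemma covers_UN:
  assumes F: "covers F A B C"
    and G: "\<And>A' B' C'. (A', B', C') \<in> F \<Longrightarrow> covers (G (A', B', C')) A' B' C'"
  shows "covers (\<Union> (G ` F)) A B C"
  unfolding covers_def
proof (intro allI impI)
  fix A\<^sub>0 B\<^sub>0 C\<^sub>0
  assume *: "A\<^sub>0 \<subseteq> A" "B\<^sub>0 \<subseteq> B" "C\<^sub>0 \<subseteq> C" "avoids R A\<^sub>0 B\<^sub>0 C\<^sub>0"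
  obtain A' B' C' where 1: "(A', B', C') \<in> F" "A\<^sub>0 \<subseteq> A'" "B\<^sub>0 \<subseteq> B'" "C\<^sub>0 \<subseteq> C'"
    using coversD [OF F *] .
  obtain A'' B'' C'' where
    "(A'', B'', C'') \<in> G (A', B', C')" "A\<^sub>0 \<subseteq> A''" "B\<^sub>0 \<subseteq> B''" "C\<^sub>0 \<subseteq> C''"
    using coversD [OF G [OF 1(1)] 1(2-) *(4)] .
  with 1(1) show "\<exists>(A', B', C')\<in>\<Union> (G ` F). A\<^sub>0 \<subseteq> A' \<and> B\<^sub>0 \<subseteq> B' \<and> C\<^sub>0 \<subseteq> C'"
    by (intro bexI [of _ "(A'', B'', C'')"]) auto
qed

text \<open>Either \<open>A\<^sub>0\<close> has few vertices of high degree, which then leave the container apart from a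
  fingerprint of at most \<open>s\<close> of them, or it contains \<open>s\<close> of them; these alone form a graph on
  \<open>B\<close> and \<open>C\<close> dense enough for a greedy fingerprint to shrink \<open>B\<close> or \<open>C\<close>.\<close>

lemma container_step:
  fixes \<delta> m :: real
  assumes sub: "A \<subseteq> V" "B \<subseteq> V" "C \<subseteq> V" and V: "V \<noteq> {}" and \<delta>: "\<delta> > 0"
    and s: "s > 0" "real s \<le> m" "real s \<le> \<delta> / 4 * card V" "card V \<le> m * (\<delta> * s / 4)"
    and e: "\<delta> * (card V)\<^sup>2 \<le> card (edges R A B C)"
  obtains F where "finite F" "card F \<le> 2 * (card (small_subsets V m))\<^sup>2"
    "\<forall>A' B' C'. (A', B', C') \<in> F \<longrightarrow> A' \<subseteq> V \<and> B' \<subseteq> V \<and> C' \<subseteq> V \<and>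
       real (card A') + card B' + card C' \<le> real (card A) + card B + card C - \<delta> / 4 * card V"
    "covers F A B C"
proof -
  let ?H = "high_degree \<delta> A B C" and ?\<S> = "small_subsets V m"
  \<comment> \<open>These containers depend only on the fingerprint \<open>S\<close> or
    \<open>(S, T)\<close>, not on the avoiding triple, so counting fingerprints bounds the
    family.\<close>
  define \<Phi> where "\<Phi> S = ((A - ?H) \<union> S, B, C)" for S
  define \<Psi> where "\<Psi> = (\<lambda>(S, T).
    (A, {y \<in> B. card (edges R S {y} (C - nbhd S T)) \<le> \<delta> * s / 4}, C - nbhd S T))"
  define P where "P = {S. S \<subseteq> ?H \<and> card S \<le> s}"
  define Q where "Q = {(S, T). S \<subseteq> ?H \<and> card S = s \<and> T \<subseteq> B \<and> real (card T) \<le> m}"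
  define F where "F = \<Phi> ` P \<union> \<Psi> ` Q"
  have HA: "?H \<subseteq> A" by (auto simp: high_degree_def)
  have P: "P \<subseteq> ?\<S>" and Q: "Q \<subseteq> ?\<S> \<times> ?\<S>"
    using HA sub s by (auto simp: P_def Q_def small_subsets_def)
  have fin\<S>: "finite ?\<S>" using finite_V by (rule finite_small_subsets)
  have finP: "finite P" and finQ: "finite Q"
    using P Q fin\<S> by (auto intro: finite_subset finite_cartesian_product)
  show thesis
  proof (rule that)
    show "finite F" using finP finQ by (simp add: F_def)
    have "card F \<le> card (\<Phi> ` P) + card (\<Psi> ` Q)" unfolding F_def by (rule card_Un_le)
    also have "\<dots> \<le> card P + card Q"
      using finP finQ by (intro add_mono card_image_le)
    also have "card P \<le> card ?\<S>" using P fin\<S> by (rule card_mono [rotated])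
    also have "card Q \<le> card (?\<S> \<times> ?\<S>)" using Q fin\<S> by (intro card_mono) auto
    also have "\<dots> = (card ?\<S>)\<^sup>2" by (simp add: card_cartesian_product power2_eq_square)
    also have "card ?\<S> + (card ?\<S>)\<^sup>2 \<le> 2 * (card ?\<S>)\<^sup>2" by (simp add: power2_eq_square)
    finally show "card F \<le> 2 * (card ?\<S>)\<^sup>2" by simp
  next
    show "\<forall>A' B' C'. (A', B', C') \<in> F \<longrightarrow> A' \<subseteq> V \<and> B' \<subseteq> V \<and> C' \<subseteq> V \<and>
       real (card A') + card B' + card C' \<le> real (card A) + card B + card C - \<delta> / 4 * card V"
    proof (intro allI impI)
      fix A' B' C' assume "(A', B', C') \<in> F"
      then consider S where "S \<in> P" "(A', B', C') = \<Phi> S"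
        | S T where "(S, T) \<in> Q" "(A', B', C') = \<Psi> (S, T)"
        by (auto simp: F_def)
      then show "A' \<subseteq> V \<and> B' \<subseteq> V \<and> C' \<subseteq> V \<and>
         real (card A') + card B' + card C' \<le> real (card A) + card B + card C - \<delta> / 4 * card V"
      proof cases
        case 1
        then have eq: "A' = (A - ?H) \<union> S" "B' = B" "C' = C" and S: "S \<subseteq> ?H" "card S \<le> s"
          by (auto simp: \<Phi>_def P_def)
        have finA: "finite A" "finite ?H" using HA sub finite_sub by (blast, blast)
        have "card A' \<le> card (A - ?H) + card S" unfolding eq by (rule card_Un_le)
        also have "card (A - ?H) = card A - card ?H"
          using HA finA by (intro card_Diff_subset)
        finally have "card A' + card ?H \<le> card A + s"
          using S card_mono [OF finA(1) HA] by linarith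
        then have "real (card A') + card ?H \<le> card A + s" by linarith
        \<comment> \<open>At least \<open>\<delta> / 2 * card V\<close> vertices leave
          \<open>A\<close>, and at most \<open>s\<close>, hence at most
          \<open>\<delta> / 4 * card V\<close>, come back with \<open>S\<close>.\<close>
        moreover have "\<delta> / 2 * card V \<le> card ?H"
          using sub V \<delta> e by (intro card_high_degree_ge) auto
        ultimately have "real (card A') \<le> card A - \<delta> / 4 * card V"
          using s(3) by simp
        with eq S HA sub show ?thesis by auto
      next
        case 2
        then have eq: "A' = A" "C' = C - nbhd S T"
            "B' = {y \<in> B. card (edges R S {y} C') \<le> \<delta> * s / 4}"
          and S: "S \<subseteq> ?H" "card S = s"
          by (auto simp: \<Psi>_def Q_def)
        have "real (card B') + card C' \<le> real (card B) + card C - \<delta> / 4 * card V"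
        proof (rule container_shrinks)
          show "S \<subseteq> V" using S HA sub by auto
          show "\<delta> / 2 * card V \<le> card (edges R {x} B C)" if "x \<in> S" for x
            using that S by (auto simp: high_degree_def)
        qed (use S s sub \<delta> eq in auto)
        then show ?thesis using eq sub by auto
      qed
    qed
  next
    show "covers F A B C"
      unfolding covers_def
    proof (intro allI impI)
      fix A\<^sub>0 B\<^sub>0 C\<^sub>0
      assume sub0: "A\<^sub>0 \<subseteq> A" "B\<^sub>0 \<subseteq> B" "C\<^sub>0 \<subseteq> C" and av: "avoids R A\<^sub>0 B\<^sub>0 C\<^sub>0"
      show "\<exists>(A', B', C')\<in>F. A\<^sub>0 \<subseteq> A' \<and> B\<^sub>0 \<subseteq> B' \<and> C\<^sub>0 \<subseteq> C'"
      proof (cases "card (A\<^sub>0 \<inter> ?H) \<le> s")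
        case True
        then have "\<Phi> (A\<^sub>0 \<inter> ?H) \<in> F" by (auto simp: F_def P_def)
        then show ?thesis
          using sub0 by (intro bexI [of _ "\<Phi> (A\<^sub>0 \<inter> ?H)"]) (auto simp: \<Phi>_def)
      next
        case False
        then obtain S where S: "S \<subseteq> A\<^sub>0 \<inter> ?H" "card S = s"
          by (meson nat_le_linear obtain_subset_with_card_n)
        let ?k = "\<delta> * s / 4"
        have k: "?k > 0" using s \<delta> by simp
        have "S \<subseteq> V" "B\<^sub>0 \<subseteq> V" using S sub sub0 by auto
        from greedy_fingerprint [OF this sub(3) k]
        obtain T where T: "T \<subseteq> B\<^sub>0" "card T * ?k \<le> card V"
          "\<And>y. y \<in> B\<^sub>0 \<Longrightarrow> card (edges R S {y} (C - nbhd S T)) < ?k" by blast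
        \<comment> \<open>Here \<open>card V \<le> m * (\<delta> * s / 4)\<close> makes
          \<open>T\<close> small enough to count as a fingerprint.\<close>
        have "card T * ?k \<le> m * ?k" using T(2) s(4) by linarith
        then have "real (card T) \<le> m" using k by (simp only: mult_le_cancel_right_pos)
        then have "(S, T) \<in> Q" using S T sub0 by (auto simp: Q_def)
        then have "\<Psi> (S, T) \<in> F" by (auto simp: F_def)
        moreover have "C\<^sub>0 \<inter> nbhd S T = {}"
          using av S T by (auto simp: avoids_def nbhd_def)
        ultimately show ?thesis
          using sub0 less_imp_le [OF T(3)] by (intro bexI [of _ "\<Psi> (S, T)"]) (auto simp: \<Psi>_def)
      qed
    qed
  qed
qed

section \<open>Iterating the container step\<close>

definition sparse_cover ::
    "real \<Rightarrow> ('a set \<times> 'a set \<times> 'a set) set \<Rightarrow> 'a set \<Rightarrow> 'a set \<Rightarrow> 'a set \<Rightarrow> bool" where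
  "sparse_cover \<delta> F A B C \<longleftrightarrow> finite F \<and> covers F A B C \<and>
    (\<forall>(A', B', C')\<in>F. A' \<subseteq> V \<and> B' \<subseteq> V \<and> C' \<subseteq> V \<and>
       real (card (edges R A' B' C')) < \<delta> * (card V)\<^sup>2)"

text \<open>The total size is a potential: a step on a triple with many edges lowers it by at least
  \<open>\<delta> / 4 * card V\<close>, so depth \<open>j\<close> suffices, and each step multiplies
  the number of containers by at most \<open>2 * (card (small_subsets V m))\<^sup>2\<close>.\<close>

lemma containers:
  fixes \<delta> m :: real
  assumes V: "V \<noteq> {}" and \<delta>: "\<delta> > 0"
    and s: "s > 0" "real s \<le> m" "real s \<le> \<delta> / 4 * card V" "card V \<le> m * (\<delta> * s / 4)"
    and sub: "A \<subseteq> V" "B \<subseteq> V" "C \<subseteq> V"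
    and j: "real (card A) + card B + card C \<le> j * (\<delta> / 4 * card V)"
  shows "\<exists>F. card F \<le> (2 * (card (small_subsets V m))\<^sup>2) ^ j \<and> sparse_cover \<delta> F A B C"
  using sub j
proof (induction j arbitrary: A B C)
  case 0
  then have "card A = 0" by simp
  then have "A = {}" using 0 finite_sub by simp
  then have "edges R A B C = {}" by (simp add: edges_def)
  then have "sparse_cover \<delta> {(A, B, C)} A B C"
    using 0 V \<delta> finite_V by (auto simp: sparse_cover_def covers_refl card_gt_0_iff)
  then show ?case by (intro exI [of _ "{(A, B, C)}"]) simp
next
  case (Suc j)
  let ?P = "2 * (card (small_subsets V m))\<^sup>2"
  show ?case
  proof (cases "card (edges R A B C) < \<delta> * (card V)\<^sup>2")
    case True
    \<comment> \<open>The factor must be positive for a single container to respect the bound at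
      depth \<open>Suc j\<close>.\<close>
    have "{} \<in> small_subsets V m" using s by (auto simp: small_subsets_def)
    then have "card (small_subsets V m) > 0"
      using finite_small_subsets [OF finite_V] card_gt_0_iff by blast
    then have "card {(A, B, C)} \<le> ?P ^ Suc j" by (simp add: Suc_le_eq)
    moreover have "sparse_cover \<delta> {(A, B, C)} A B C"
      using True Suc.prems by (auto simp: sparse_cover_def covers_refl)
    ultimately show ?thesis by blast
  next
    case False
    then have e: "\<delta> * (card V)\<^sup>2 \<le> card (edges R A B C)" by simp
    obtain F where F: "finite F" "card F \<le> ?P"
      "\<forall>A' B' C'. (A', B', C') \<in> F \<longrightarrow> A' \<subseteq> V \<and> B' \<subseteq> V \<and> C' \<subseteq> V \<and>
         real (card A') + card B' + card C' \<le> real (card A) + card B + card C - \<delta> / 4 * card V"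
      "covers F A B C"
      using container_step [OF Suc.prems(1-3) V \<delta> s e] .
    have "\<forall>X\<in>F. \<exists>G. card G \<le> ?P ^ j \<and> (case X of (A', B', C') \<Rightarrow> sparse_cover \<delta> G A' B' C')"
    proof
      fix X assume "X \<in> F"
      then obtain A' B' C' where X: "X = (A', B', C')" "(A', B', C') \<in> F" by (cases X) auto
      have *: "A' \<subseteq> V" "B' \<subseteq> V" "C' \<subseteq> V"
        "real (card A') + card B' + card C' \<le> j * (\<delta> / 4 * card V)"
        using F(3) [rule_format, OF X(2)] Suc.prems(4) by (auto simp: algebra_simps)
      show "\<exists>G. card G \<le> ?P ^ j \<and> (case X of (A', B', C') \<Rightarrow> sparse_cover \<delta> G A' B' C')"
        unfolding X prod.case by (rule Suc.IH [OF *])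
    qed
    from bchoice [OF this] obtain G where
      G: "\<forall>X\<in>F. card (G X) \<le> ?P ^ j \<and> (case X of (A', B', C') \<Rightarrow> sparse_cover \<delta> (G X) A' B' C')"
      by (rule exE)
    have "card (\<Union> (G ` F)) \<le> (\<Sum>X\<in>F. card (G X))" by (rule card_UN_le) (fact F(1))
    also have "\<dots> \<le> (\<Sum>X\<in>F. ?P ^ j)" by (rule sum_mono) (use G in blast)
    also have "\<dots> = card F * ?P ^ j" by simp
    also have "\<dots> \<le> ?P * ?P ^ j" using F(2) by (rule mult_right_mono) simp
    finally have "card (\<Union> (G ` F)) \<le> ?P ^ Suc j" by simp
    moreover have "covers (\<Union> (G ` F)) A B C"
      using F(4) G by (intro covers_UN) (auto simp: sparse_cover_def)
    then have "sparse_cover \<delta> (\<Union> (G ` F)) A B C"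
      using F(1) G unfolding sparse_cover_def by fastforce
    ultimately show ?thesis by blast
  qed
qed

section \<open>Triples with three large components\<close>

definition large_triples :: "real \<Rightarrow> ('a set \<times> 'a set \<times> 'a set) set" where
  "large_triples m = {(A, B, C) \<in> avoiding_triples V R.
     m \<le> card A \<and> m \<le> card B \<and> m \<le> card C}"

text \<open>The value \<open>\<delta> = \<epsilon> / 45\<close> is \<open>\<theta> = 1/45\<close> in
  \<open>total_size_le\<close>: a container that holds a large triple has total size at most
  \<open>23/15 * card V\<close>. It then holds at most \<open>2 powr (23/15 * card V)\<close>
  triples, and \<open>2 ^ 23 \<le> (29/10) ^ 15\<close>.\<close>

lemma card_large_triples_le:
  fixes \<epsilon> m :: real
  assumes V: "V \<noteq> {}" and \<epsilon>: "\<epsilon> > 0" and \<delta>: "\<delta> = \<epsilon> / 45"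
    and s: "s > 0" "real s \<le> m" "real s \<le> \<delta> / 4 * card V" "card V \<le> m * (\<delta> * s / 4)"
    and j: "3 \<le> j * (\<delta> / 4)"
  shows "real (card (large_triples (\<epsilon> * card V)))
    \<le> (2 * (real (card (small_subsets V m)))\<^sup>2) ^ j * (29/10) ^ card V"
proof -
  let ?d = "card V" and ?P = "2 * (card (small_subsets V m))\<^sup>2"
  let ?L = "large_triples (\<epsilon> * ?d)"
  have \<delta>0: "\<delta> > 0" using \<epsilon> \<delta> by simp
  have "3 * real ?d \<le> j * (\<delta> / 4) * ?d" using j by (rule mult_right_mono) simp
  then have total: "real ?d + ?d + ?d \<le> j * (\<delta> / 4 * ?d)" by simp
  obtain F where F: "card F \<le> ?P ^ j" "sparse_cover \<delta> F V V V"
    using containers [OF V \<delta>0 s order_refl order_refl order_refl total] by blast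
  then have finF: "finite F" and cover: "covers F V V V"
    by (auto simp: sparse_cover_def)
  define D where "D = (\<lambda>(A, B, C). {(A\<^sub>0, B\<^sub>0, C\<^sub>0) \<in> ?L. A\<^sub>0 \<subseteq> A \<and> B\<^sub>0 \<subseteq> B \<and> C\<^sub>0 \<subseteq> C})"
  have finL: "finite ?L"
    using finite_avoiding_triples [OF finite_V]
    by (rule finite_subset [rotated]) (auto simp: large_triples_def)
  have D: "real (card (D X)) \<le> (29/10) ^ ?d" if "X \<in> F" for X
  proof -
    obtain A B C where X: "X = (A, B, C)" by (cases X)
    have ABC: "A \<subseteq> V" "B \<subseteq> V" "C \<subseteq> V" "card (edges R A B C) < \<delta> * ?d\<^sup>2"
      using F(2) that X by (auto simp: sparse_cover_def)
    then have fin: "finite A" "finite B" "finite C" by (auto simp: finite_sub)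
    show ?thesis
    \<comment> \<open>Only a container holding some large triple is known to have three components
      of size at least \<open>\<epsilon> * card V\<close>; the others contribute nothing.\<close>
    proof (cases "D X = {}")
      case False
      then obtain A\<^sub>0 B\<^sub>0 C\<^sub>0 where "(A\<^sub>0, B\<^sub>0, C\<^sub>0) \<in> ?L" "A\<^sub>0 \<subseteq> A" "B\<^sub>0 \<subseteq> B" "C\<^sub>0 \<subseteq> C"
        by (auto simp: D_def X)
      moreover from this have "card A\<^sub>0 \<le> card A" "card B\<^sub>0 \<le> card B" "card C\<^sub>0 \<le> card C"
        using fin by (simp_all add: card_mono)
      ultimately have "\<epsilon> * ?d \<le> card A" "\<epsilon> * ?d \<le> card B" "\<epsilon> * ?d \<le> card C"
        by (auto simp: large_triples_def)
      then have "2 * (real (card A) + card B + card C) \<le> 3 * (1 + 1/45) * ?d"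
        using ABC \<delta> by (intro total_size_le [where \<epsilon> = \<epsilon>]) auto
      then have "15 * (real (card A) + card B + card C) \<le> 23 * real ?d"
        by simp
      then have "real (15 * (card A + card B + card C)) \<le> real (23 * ?d)"
        by (simp only: of_nat_mult of_nat_add of_nat_numeral)
      then have n: "15 * (card A + card B + card C) \<le> 23 * ?d"
        by (simp only: of_nat_le_iff)
      have "card (D X) \<le> card (Pow A \<times> Pow B \<times> Pow C)"
        using fin by (intro card_mono) (auto simp: D_def X)
      also have "\<dots> = 2 ^ (card A + card B + card C)"
        using fin by (simp add: card_cartesian_product card_Pow power_add)
      finally have 1: "real (card (D X)) \<le> 2 ^ (card A + card B + card C)"
        by (metis of_nat_le_iff of_nat_numeral of_nat_power)
      have "((2::real) ^ (card A + card B + card C)) ^ 15 = 2 ^ (15 * (card A + card B + card C))"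
        by (simp add: mult.commute flip: power_mult)
      also have "\<dots> \<le> 2 ^ (23 * ?d)" using n by (intro power_increasing) auto
      also have "\<dots> = (2 ^ 23) ^ ?d" by (simp add: power_mult)
      also have "\<dots> \<le> ((29/10) ^ 15) ^ ?d" by (intro power_mono) (simp_all add: power_divide)
      also have "\<dots> = ((29/10) ^ ?d) ^ 15" by (simp add: mult.commute flip: power_mult)
      finally have "(2::real) ^ (card A + card B + card C) \<le> (29/10) ^ ?d"
        by (rule power_le_imp_le_base [where n = 14, simplified]) simp
      with 1 show ?thesis by linarith
    qed simp
  qed
  have "?L \<subseteq> (\<Union>X\<in>F. D X)"
  proof
    fix X assume X: "X \<in> ?L"
    obtain A\<^sub>0 B\<^sub>0 C\<^sub>0 where eq: "X = (A\<^sub>0, B\<^sub>0, C\<^sub>0)" by (cases X)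
    then have "A\<^sub>0 \<subseteq> V" "B\<^sub>0 \<subseteq> V" "C\<^sub>0 \<subseteq> V" "avoids R A\<^sub>0 B\<^sub>0 C\<^sub>0"
      using X by (auto simp: large_triples_def avoiding_triples_def)
    from coversD [OF cover this] obtain A B C
      where "(A, B, C) \<in> F" "A\<^sub>0 \<subseteq> A" "B\<^sub>0 \<subseteq> B" "C\<^sub>0 \<subseteq> C" .
    with X show "X \<in> (\<Union>X\<in>F. D X)"
      by (intro UN_I [of "(A, B, C)"]) (auto simp: eq D_def)
  qed
  moreover have "finite (\<Union>X\<in>F. D X)"
    by (rule finite_subset [OF _ finL]) (auto simp: D_def)
  ultimately have "card ?L \<le> card (\<Union>X\<in>F. D X)" by (intro card_mono)
  also have "\<dots> \<le> (\<Sum>X\<in>F. card (D X))" by (rule card_UN_le) (fact finF)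
  finally have "real (card ?L) \<le> (\<Sum>X\<in>F. real (card (D X)))"
    by (simp flip: of_nat_sum)
  also have "\<dots> \<le> (\<Sum>X\<in>F. (29/10) ^ ?d)" by (rule sum_mono) (rule D)
  also have "\<dots> = card F * (29/10) ^ ?d" by simp
  also have "\<dots> \<le> real (?P ^ j) * (29/10) ^ ?d"
    using F(1) by (intro mult_right_mono of_nat_mono) auto
  finally show ?thesis by simp
qed

end

section \<open>Counting\<close>

text \<open>The parameters \<open>\<delta>\<close>, \<open>j\<close>, \<open>q\<close>,
  \<open>\<eta>\<close>, \<open>s\<close>, \<open>d\<^sub>0\<close> are fixed in this order, each
  from \<open>\<epsilon>\<close> and earlier ones only, so \<open>K\<close> serves all squares at
  once. In particular \<open>j\<close> and \<open>s\<close> stay constant while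
  \<open>card V\<close> grows.\<close>

lemma card_large_triples_bound:
  fixes \<epsilon> :: real
  assumes \<epsilon>: "\<epsilon> > 0"
  obtains K :: real where "K > 0"
    "\<And>(V :: 'a set) R. latin_square V R \<Longrightarrow>
       real (card (latin_square.large_triples V R (\<epsilon> * card V))) \<le> K * (59/20) ^ card V"
proof -
  define \<delta> where "\<delta> = \<epsilon> / 45"
  have \<delta>: "\<delta> > 0" using \<epsilon> by (simp add: \<delta>_def)
  obtain j :: nat where j: "12 / \<delta> < j" using reals_Archimedean2 by blast
  moreover have "0 < 12 / \<delta>" using \<delta> by simp
  ultimately have j0: "j > 0" by (metis less_trans of_nat_0_less_iff)
  have j3: "3 \<le> j * (\<delta> / 4)" using j \<delta> by (simp add: field_simps)
  \<comment> \<open>With at most \<open>q ^ card V\<close> small subsets, the exponential part of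
    the container count is \<open>(59/58) ^ card V\<close>, and
    \<open>59/58 * 29/10 = 59/20\<close>.\<close>
  define q where "q = root (2 * j) (59/58 :: real)"
  have q1: "q > 1" using j0 by (simp add: q_def)
  have q: "(q ^ 2) ^ j = 59/58" using j0 by (simp add: q_def flip: power_mult)
  obtain \<eta> :: real where \<eta>: "\<eta> > 0"
    "\<And>V :: 'a set. finite V \<Longrightarrow> real (card (small_subsets V (\<eta> * card V))) \<le> q ^ card V"
    using card_small_subsets_le [OF q1] by blast
  \<comment> \<open>Such an \<open>s\<close> keeps the greedy fingerprint, of size at most
    \<open>card V / (\<delta> * s / 4)\<close>, within \<open>\<eta> * card V\<close>.\<close>
  obtain s :: nat where s: "4 / (\<eta> * \<delta>) < s" using reals_Archimedean2 by blast
  moreover have "0 < 4 / (\<eta> * \<delta>)" using \<delta> \<eta> by simp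
  ultimately have s0: "s > 0" by (metis less_trans of_nat_0_less_iff)
  obtain d\<^sub>0 :: nat where d0: "max (s / \<eta>) (4 * s / \<delta>) < d\<^sub>0" using reals_Archimedean2 by blast
  \<comment> \<open>The summand \<open>2 ^ j\<close> comes from the container count;
    \<open>8 ^ d\<^sub>0\<close> covers the sizes below \<open>d\<^sub>0\<close>, where
    \<open>s\<close> may exceed the thresholds proportional to \<open>card V\<close>.\<close>
  define K :: real where "K = 2 ^ j + 8 ^ d\<^sub>0"
  show thesis
  proof (rule that)
    show "K > 0" by (simp add: K_def add_pos_pos)
    fix V :: "'a set" and R assume "latin_square V R"
    then interpret latin_square V R .
    let ?d = "card V"
    show "real (card (large_triples (\<epsilon> * ?d))) \<le> K * (59/20) ^ ?d"
    proof (cases "?d < d\<^sub>0")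
      case True
      have "card (large_triples (\<epsilon> * ?d)) \<le> card (avoiding_triples V R)"
        using finite_avoiding_triples [OF finite_V]
        by (intro card_mono) (auto simp: large_triples_def)
      also have "\<dots> \<le> 8 ^ ?d" using finite_V by (rule card_avoiding_triples_le)
      also have "\<dots> \<le> 8 ^ d\<^sub>0" using True by (intro power_increasing) auto
      finally have "real (card (large_triples (\<epsilon> * ?d))) \<le> 8 ^ d\<^sub>0"
        by (metis of_nat_le_iff of_nat_numeral of_nat_power)
      also have "\<dots> \<le> K * 1" by (simp add: K_def)
      also have "\<dots> \<le> K * (59/20) ^ ?d" by (intro mult_left_mono) (auto simp: K_def)
      finally show ?thesis .
    next
      case False
      then have "real d\<^sub>0 \<le> ?d" by simp
      with d0 have d: "s / \<eta> \<le> ?d" "4 * s / \<delta> \<le> ?d" by linarith+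
      have "0 < 4 * s / \<delta>" using s0 \<delta> by simp
      with d have "V \<noteq> {}" by auto
      have s1: "s \<le> \<eta> * ?d" "s \<le> \<delta> / 4 * ?d"
        using d \<eta> \<delta> by (simp_all add: field_simps)
      have "4 \<le> \<eta> * \<delta> * s" using s \<eta> \<delta> by (simp add: field_simps)
      then have "4 * real ?d \<le> \<eta> * \<delta> * s * ?d" by (rule mult_right_mono) simp
      then have s2: "?d \<le> \<eta> * ?d * (\<delta> * s / 4)" by (simp add: mult_ac)
      let ?S = "real (card (small_subsets V (\<eta> * ?d)))"
      have "real (card (large_triples (\<epsilon> * ?d))) \<le> (2 * ?S\<^sup>2) ^ j * (29/10) ^ ?d"
        using \<open>V \<noteq> {}\<close> \<epsilon> \<delta>_def s0 s1 s2 j3 by (rule card_large_triples_le)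
      also have "\<dots> \<le> (2 * (q ^ ?d)\<^sup>2) ^ j * (29/10) ^ ?d"
        using \<eta>(2) [OF finite_V] by (intro mult_right_mono mult_left_mono power_mono) auto
      also have "(2 * (q ^ ?d)\<^sup>2) ^ j = 2 ^ j * ((q ^ 2) ^ j) ^ ?d"
        by (simp add: power_mult_distrib mult_ac flip: power_mult)
      also have "\<dots> * (29/10) ^ ?d = 2 ^ j * (59/20) ^ ?d"
        by (simp add: q flip: power_mult_distrib)
      also have "\<dots> \<le> K * (59/20) ^ ?d" by (simp add: K_def)
      finally show ?thesis .
    qed
  qed
qed

section \<open>Error terms and inclusion-exclusion\<close>

lemma square_mult_power_2_le: "real ((d + 1)\<^sup>2 * 2 ^ d) \<le> 25 * (59/20) ^ d"
proof -
  \<comment> \<open>The base 6/5 works because \<open>(6/5)\<^sup>2 * 2 = 72/25\<close> stays below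
    \<open>59/20\<close>.\<close>
  have "1 + real d * (1/5) \<le> (1 + 1/5) ^ d" by (rule Bernoulli_inequality) simp
  also have "(1 + 1/5 :: real) = 6/5" by simp
  finally have "real d + 1 \<le> 5 * (6/5) ^ d" by linarith
  then have "(real d + 1)\<^sup>2 \<le> (5 * (6/5) ^ d)\<^sup>2" by (intro power_mono) auto
  then have "(real d + 1)\<^sup>2 * 2 ^ d \<le> (5 * (6/5) ^ d)\<^sup>2 * 2 ^ d" by (rule mult_right_mono) simp
  also have "\<dots> = 25 * ((6/5)\<^sup>2 * 2) ^ d"
    by (simp add: power_mult_distrib mult.commute flip: power_mult)
  also have "\<dots> \<le> 25 * (59/20) ^ d"
    by (intro mult_left_mono power_mono) (auto simp: power2_eq_square)
  finally show ?thesis by (simp add: add.commute)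
qed

text \<open>Bonferroni's lower bound, in additive form to avoid subtraction of natural
  numbers.\<close>

lemma card_Un3_ge:
  assumes "finite X" "finite Y" "finite Z"
  shows "card X + card Y + card Z
    \<le> card (X \<union> Y \<union> Z) + card (X \<inter> Y) + card (X \<inter> Z) + card (Y \<inter> Z)"
proof -
  have "card X + card Y = card (X \<union> Y) + card (X \<inter> Y)"
    using assms by (intro card_Un_Int)
  moreover have "card (X \<union> Y) + card Z = card (X \<union> Y \<union> Z) + card ((X \<union> Y) \<inter> Z)"
    using assms by (intro card_Un_Int) auto
  moreover have "card ((X \<union> Y) \<inter> Z) \<le> card (X \<inter> Z) + card (Y \<inter> Z)"
    unfolding Int_Un_distrib2 by (rule card_Un_le)
  ultimately show ?thesis by linarith
qed

lemma card_Un3_le: "card (X \<union> Y \<union> Z) \<le> card X + card Y + card Z"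
  by (meson add_mono_thms_linordered_semiring(3) card_Un_le le_trans)

context latin_square
begin

text \<open>Avoidance is simply dropped: there are at most \<open>card V + 1\<close> choices for
  each of \<open>A\<close> and \<open>B\<close>, and \<open>C\<close> is arbitrary.\<close>

lemma card_fst_snd_le_1:
  "card {(A, B, C) \<in> avoiding_triples V R. card A \<le> 1 \<and> card B \<le> 1} \<le> (card V + 1)\<^sup>2 * 2 ^ card V"
proof -
  let ?S = "insert {} ((\<lambda>x. {x}) ` V)"
  have "card ?S \<le> card V + 1"
    using finite_V by (simp add: card_insert_if card_image_le le_SucI)
  have "card {(A, B, C) \<in> avoiding_triples V R. card A \<le> 1 \<and> card B \<le> 1}
      \<le> card (?S \<times> ?S \<times> Pow V)"
    using finite_V subsets_card_le_1 by (intro card_mono) (auto simp: avoiding_triples_def)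
  also have "\<dots> = card ?S * card ?S * 2 ^ card V"
    using finite_V by (simp add: card_cartesian_product card_Pow del: insert_iff)
  also have "\<dots> \<le> (card V + 1) * (card V + 1) * 2 ^ card V"
    using \<open>card ?S \<le> card V + 1\<close> by (intro mult_right_mono mult_mono) auto
  finally show ?thesis by (simp add: power2_eq_square)
qed

text \<open>The counts of triples with a given component of size at most one add up to exactly
  \<open>3 * 4 ^ d + d * 3 ^ (d + 1)\<close>; the double count is negligible.\<close>

lemma card_avoiding_triples_approx:
  fixes \<epsilon> K :: real
  assumes small: "real (card (small_subsets V (\<epsilon> * card V))) \<le> (101/100) ^ card V"
    and large: "real (card (large_triples (\<epsilon> * card V))) \<le> K * (59/20) ^ card V"
  shows "\<bar>real (card (avoiding_triples V R)) - 3 * 4 ^ card V - real (card V) * 3 ^ (card V + 1)\<bar>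
    \<le> (K + 78) * (59/20) ^ card V"
proof -
  let ?d = "card V" and ?T = "avoiding_triples V R"
  interpret s12: latin_square V "\<lambda>x y z. R y x z" by (rule swap12)
  interpret s13: latin_square V "\<lambda>x y z. R z y x" by (rule swap13)
  interpret s23: latin_square V "\<lambda>x y z. R y z x" by (rule s12.swap13)
  define X\<^sub>1 where "X\<^sub>1 = {(A, B, C) \<in> ?T. card A \<le> 1}"
  define X\<^sub>2 where "X\<^sub>2 = {(A, B, C) \<in> ?T. card B \<le> 1}"
  define X\<^sub>3 where "X\<^sub>3 = {(A, B, C) \<in> ?T. card C \<le> 1}"
  define Y\<^sub>1 where "Y\<^sub>1 = {(A, B, C) \<in> ?T. 2 \<le> card A \<and> card A \<le> \<epsilon> * ?d}"
  define Y\<^sub>2 where "Y\<^sub>2 = {(A, B, C) \<in> ?T. 2 \<le> card B \<and> card B \<le> \<epsilon> * ?d}"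
  define Y\<^sub>3 where "Y\<^sub>3 = {(A, B, C) \<in> ?T. 2 \<le> card C \<and> card C \<le> \<epsilon> * ?d}"
  let ?L = "large_triples (\<epsilon> * ?d)"
  note swaps = card_avoiding_triples_swap12 [where R = R and V = V]
    card_avoiding_triples_swap13 [where R = R and V = V]
  have finT: "finite ?T" using finite_V by (rule finite_avoiding_triples)
  have fin: "finite X\<^sub>1" "finite X\<^sub>2" "finite X\<^sub>3" "finite Y\<^sub>1" "finite Y\<^sub>2" "finite Y\<^sub>3" "finite ?L"
    unfolding X\<^sub>1_def X\<^sub>2_def X\<^sub>3_def Y\<^sub>1_def Y\<^sub>2_def Y\<^sub>3_def large_triples_def
    by (rule finite_subset [OF _ finT], blast)+
  have X: "card X\<^sub>1 = 4 ^ ?d + ?d * 3 ^ ?d" "card X\<^sub>2 = 4 ^ ?d + ?d * 3 ^ ?d"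
      "card X\<^sub>3 = 4 ^ ?d + ?d * 3 ^ ?d"
    unfolding X\<^sub>1_def X\<^sub>2_def X\<^sub>3_def
    using card_fst_le_1 s12.card_fst_le_1 s13.card_fst_le_1
      swaps(1) [of "\<lambda>A B C. card A \<le> 1"] swaps(2) [of "\<lambda>A B C. card A \<le> 1"]
    by simp_all
  have "card (X\<^sub>1 \<inter> X\<^sub>2) = card {(A, B, C) \<in> ?T. card A \<le> 1 \<and> card B \<le> 1}"
    unfolding X\<^sub>1_def X\<^sub>2_def by (rule arg_cong [where f = card]) auto
  also have "\<dots> \<le> (?d + 1)\<^sup>2 * 2 ^ ?d" by (rule card_fst_snd_le_1)
  finally have X12: "card (X\<^sub>1 \<inter> X\<^sub>2) \<le> (?d + 1)\<^sup>2 * 2 ^ ?d" .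
  have "card (X\<^sub>2 \<inter> X\<^sub>3) = card {(A, B, C) \<in> ?T. card C \<le> 1 \<and> card B \<le> 1}"
    unfolding X\<^sub>2_def X\<^sub>3_def by (rule arg_cong [where f = card]) auto
  also have "\<dots> \<le> (?d + 1)\<^sup>2 * 2 ^ ?d"
    using s13.card_fst_snd_le_1 swaps(2) [of "\<lambda>A B C. card A \<le> 1 \<and> card B \<le> 1"] by simp
  finally have X23: "card (X\<^sub>2 \<inter> X\<^sub>3) \<le> (?d + 1)\<^sup>2 * 2 ^ ?d" .
  have "card (X\<^sub>1 \<inter> X\<^sub>3) = card {(A, B, C) \<in> ?T. card A \<le> 1 \<and> card C \<le> 1}"
    unfolding X\<^sub>1_def X\<^sub>3_def by (rule arg_cong [where f = card]) auto
  \<comment> \<open>Two swaps in succession bring the first and third components to the two leading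
    positions.\<close>
  also have "\<dots> = card {(A, B, C) \<in> avoiding_triples V (\<lambda>x y z. R y x z). card B \<le> 1 \<and> card C \<le> 1}"
    by (rule swaps(1) [of "\<lambda>A B C. card B \<le> 1 \<and> card C \<le> 1"])
  also have "\<dots> = card {(A, B, C) \<in> avoiding_triples V (\<lambda>x y z. R y z x). card B \<le> 1 \<and> card A \<le> 1}"
    by (rule card_avoiding_triples_swap13 [where P = "\<lambda>A B C. card B \<le> 1 \<and> card A \<le> 1"])
  also have "\<dots> \<le> (?d + 1)\<^sup>2 * 2 ^ ?d" using s23.card_fst_snd_le_1 by (simp add: conj_commute)
  finally have X13: "card (X\<^sub>1 \<inter> X\<^sub>3) \<le> (?d + 1)\<^sup>2 * 2 ^ ?d" .
  have "real (card Y\<^sub>1) \<le> card (small_subsets V (\<epsilon> * ?d)) * (29/10) ^ ?d"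
      "real (card Y\<^sub>2) \<le> card (small_subsets V (\<epsilon> * ?d)) * (29/10) ^ ?d"
      "real (card Y\<^sub>3) \<le> card (small_subsets V (\<epsilon> * ?d)) * (29/10) ^ ?d"
    unfolding Y\<^sub>1_def Y\<^sub>2_def Y\<^sub>3_def
    using card_fst_small_le s12.card_fst_small_le s13.card_fst_small_le
      swaps(1) [of "\<lambda>A B C. 2 \<le> card A \<and> card A \<le> \<epsilon> * ?d"]
      swaps(2) [of "\<lambda>A B C. 2 \<le> card A \<and> card A \<le> \<epsilon> * ?d"]
    by simp_all
  moreover have "card (small_subsets V (\<epsilon> * ?d)) * (29/10) ^ ?d \<le> (59/20 :: real) ^ ?d"
  proof -
    have "card (small_subsets V (\<epsilon> * ?d)) * (29/10) ^ ?d \<le> (101/100) ^ ?d * (29/10 :: real) ^ ?d"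
      using small by (rule mult_right_mono) simp
    also have "\<dots> = (2929/1000) ^ ?d" by (simp flip: power_mult_distrib)
    also have "\<dots> \<le> (59/20) ^ ?d" by (intro power_mono) auto
    finally show ?thesis .
  qed
  ultimately have Y: "real (card Y\<^sub>1) \<le> (59/20) ^ ?d" "real (card Y\<^sub>2) \<le> (59/20) ^ ?d"
      "real (card Y\<^sub>3) \<le> (59/20) ^ ?d" by linarith+
  have Un: "X\<^sub>1 \<union> X\<^sub>2 \<union> X\<^sub>3 \<subseteq> ?T"
    by (auto simp: X\<^sub>1_def X\<^sub>2_def X\<^sub>3_def)
  \<comment> \<open>A component of size at least 2 that escapes its \<open>Y\<close> set exceeds
    \<open>\<epsilon> * card V\<close>; if all three do so, the triple is large.\<close>
  have "?T \<subseteq> (X\<^sub>1 \<union> X\<^sub>2 \<union> X\<^sub>3) \<union> ((Y\<^sub>1 \<union> Y\<^sub>2 \<union> Y\<^sub>3) \<union> ?L)"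
    unfolding X\<^sub>1_def X\<^sub>2_def X\<^sub>3_def Y\<^sub>1_def Y\<^sub>2_def Y\<^sub>3_def large_triples_def by auto
  then have "card ?T \<le> card ((X\<^sub>1 \<union> X\<^sub>2 \<union> X\<^sub>3) \<union> ((Y\<^sub>1 \<union> Y\<^sub>2 \<union> Y\<^sub>3) \<union> ?L))"
    using fin by (intro card_mono) auto
  also have "\<dots> \<le> card X\<^sub>1 + card X\<^sub>2 + card X\<^sub>3 + (card Y\<^sub>1 + card Y\<^sub>2 + card Y\<^sub>3 + card ?L)"
    using card_Un_le [of "X\<^sub>1 \<union> X\<^sub>2 \<union> X\<^sub>3" "(Y\<^sub>1 \<union> Y\<^sub>2 \<union> Y\<^sub>3) \<union> ?L"]
      card_Un_le [of "Y\<^sub>1 \<union> Y\<^sub>2 \<union> Y\<^sub>3" ?L]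
      card_Un3_le [of X\<^sub>1 X\<^sub>2 X\<^sub>3] card_Un3_le [of Y\<^sub>1 Y\<^sub>2 Y\<^sub>3] by linarith
  finally have "real (card ?T) - (real (card X\<^sub>1) + card X\<^sub>2 + card X\<^sub>3) \<le> (K + 3) * (59/20) ^ ?d"
    using Y large by (simp add: algebra_simps)
  \<comment> \<open>Three double counts of at most \<open>25 * (59/20) ^ card V\<close> each give
    75; adding the \<open>K + 3\<close> of the upper estimate gives \<open>K + 78\<close>.\<close>
  moreover have "(real (card X\<^sub>1) + card X\<^sub>2 + card X\<^sub>3) - card ?T \<le> 75 * (59/20) ^ ?d"
    using card_Un3_ge [OF fin(1-3)] card_mono [OF finT Un] X12 X13 X23
      square_mult_power_2_le [of ?d] by linarith
  moreover have "real (card X\<^sub>1) + card X\<^sub>2 + card X\<^sub>3 = 3 * 4 ^ ?d + real ?d * 3 ^ (?d + 1)"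
    by (simp add: X algebra_simps)
  moreover have "(K + 78) * (59/20) ^ ?d = (K + 3) * (59/20) ^ ?d + 75 * (59/20) ^ ?d"
    by (simp add: algebra_simps)
  moreover have "(59/20 :: real) ^ ?d \<ge> 0" by simp
  \<comment> \<open>By \<open>large\<close>, \<open>K * (59/20) ^ card V\<close> bounds a
    cardinality and is nonnegative, so the lower estimate also fits under the common bound.\<close>
  moreover from this have "(K + 3) * (59/20) ^ ?d \<ge> 0"
    using large unfolding distrib_right by linarith
  ultimately show ?thesis by linarith
qed

end

section \<open>Addition modulo \<open>d\<close> and the hypergraph\<close>

lemma latin_square_add_mod: "latin_square {..<d :: nat} (\<lambda>x y z. (x + y) mod d = z)"
proof
  fix x z :: nat assume x: "x \<in> {..<d}" and z: "z \<in> {..<d}"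
  show "\<exists>!y. y \<in> {..<d} \<and> (x + y) mod d = z"
  proof (rule ex1I)
    \<comment> \<open>The term \<open>z + (d - x)\<close> represents \<open>z - x\<close> modulo
      \<open>d\<close>; as \<open>x < d\<close>, the natural subtraction is exact.\<close>
    show "(z + (d - x)) mod d \<in> {..<d} \<and> (x + (z + (d - x)) mod d) mod d = z"
      using x z by (simp add: mod_add_right_eq)
    fix y assume y: "y \<in> {..<d} \<and> (x + y) mod d = z"
    then have "(z + (d - x)) mod d = (x + y + (d - x)) mod d"
      by (metis mod_add_left_eq)
    also have "\<dots> = y" using x y by simp
    finally show "y = (z + (d - x)) mod d" by simp
  qed
  then show "\<exists>!y. y \<in> {..<d} \<and> (y + x) mod d = z"
    by (simp add: add.commute)
qed auto

text \<open>A vertex set is recovered from its three fibres, and an edge inside it is the same as a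
  triple from the fibres satisfying the relation.\<close>

lemma i_Hmod_eq: "i_Hmod d = card (avoiding_triples {..<d} (\<lambda>x y z. (x + y) mod d = z))"
  unfolding i_Hmod_def num_indep_def
proof (rule bij_betw_same_card, rule bij_betw_byWitness)
  let ?T = "avoiding_triples {..<d} (\<lambda>x y z. (x + y) mod d = z)"
  let ?I = "{W. independent_set (Hmod_V d) (Hmod_E d) W}"
  let ?f = "\<lambda>W :: (nat \<times> nat) set. (Pair 0 -` W, Pair 1 -` W, Pair 2 -` W)"
  let ?g = "\<lambda>(A, B, C). Pair (0::nat) ` A \<union> Pair 1 ` B \<union> Pair 2 ` (C :: nat set)"
  show "\<forall>W\<in>?I. ?g (?f W) = W"
  proof
    fix W assume "W \<in> ?I"
    then have "i = 0 \<or> i = 1 \<or> i = 2" if "(i, x) \<in> W" for i x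
      using that by (auto simp: independent_set_def Hmod_V_def)
    then have "W \<subseteq> ?g (?f W)" by fastforce
    moreover have "?g (?f W) \<subseteq> W" by auto
    ultimately show "?g (?f W) = W" by (rule equalityI [rotated])
  qed
  show "\<forall>X\<in>?T. ?f (?g X) = X"
    by auto
  show "?f ` ?I \<subseteq> ?T"
  proof
    fix X assume "X \<in> ?f ` ?I"
    then obtain W where W: "X = ?f W" "W \<subseteq> {0, 1, 2} \<times> {..<d}"
      and ind: "\<And>e. e \<in> Hmod_E d \<Longrightarrow> \<not> e \<subseteq> W"
      by (auto simp: independent_set_def Hmod_V_def)
    have "\<not> ((0, x) \<in> W \<and> (1, y) \<in> W \<and> (2, (x + y) mod d) \<in> W)" for x y
    proof
      assume *: "(0, x) \<in> W \<and> (1, y) \<in> W \<and> (2, (x + y) mod d) \<in> W"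
      with W(2) have "x < d" "y < d" "(x + y) mod d < d" by auto
      then have "{(0, x), (1, y), (2, (x + y) mod d)} \<in> Hmod_E d"
        unfolding Hmod_E_def by blast
      from ind [OF this] * show False by simp
    qed
    with W show "X \<in> ?T" by (auto simp: avoiding_triples_def avoids_def)
  qed
  show "?g ` ?T \<subseteq> ?I"
  proof (rule image_subsetI)
    fix X assume X: "X \<in> ?T"
    obtain A B C where X_eq: "X = (A, B, C)" by (cases X)
    with X have ABC: "(A, B, C) \<in> ?T" by simp
    have "\<not> e \<subseteq> ?g (A, B, C)" if e: "e \<in> Hmod_E d" for e
    proof
      assume sub: "e \<subseteq> ?g (A, B, C)"
      obtain x y z where e_eq: "e = {(0, x), (1, y), (2, z)}" and z: "(x + y) mod d = z"
        using e unfolding Hmod_E_def by blast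
      have "x \<in> A" "y \<in> B" "z \<in> C"
        using sub unfolding e_eq by (simp_all add: image_iff)
      with ABC z show False unfolding avoiding_triples_def avoids_def by blast
    qed
    moreover have "?g (A, B, C) \<subseteq> Hmod_V d"
      using ABC by (auto simp: avoiding_triples_def Hmod_V_def)
    ultimately show "?g X \<in> ?I"
      unfolding independent_set_def X_eq by blast
  qed
qed

theorem theorem1:
  shows "\<exists>c::real. c > 0 \<and> (\<exists>K::real. K > 0 \<and>
           (\<forall>d::nat. d \<ge> 1 \<longrightarrow>
              \<bar>real (i_Hmod d) - 3 * 4 ^ d - real d * 3 ^ (d + 1)\<bar> \<le> K * (3 - c) ^ d))"
proof -
  obtain \<epsilon> :: real where \<epsilon>: "\<epsilon> > 0"
    "\<And>V :: nat set. finite V \<Longrightarrow> real (card (small_subsets V (\<epsilon> * card V))) \<le> (101/100) ^ card V"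
    using card_small_subsets_le [of "101/100"] by auto
  obtain K :: real where K: "K > 0"
    "\<And>(V :: nat set) R. latin_square V R \<Longrightarrow>
       real (card (latin_square.large_triples V R (\<epsilon> * card V))) \<le> K * (59/20) ^ card V"
    using card_large_triples_bound [OF \<epsilon>(1)] by blast
  show ?thesis
  proof (intro exI conjI allI impI)
    \<comment> \<open>The witness is \<open>c = 1/20\<close> because
      \<open>3 - 1/20 = 59/20\<close>.\<close>
    show "(1/20 :: real) > 0" "K + 78 > 0" using K by simp_all
    fix d :: nat
    interpret latin_square "{..<d}" "\<lambda>x y z. (x + y) mod d = z" by (rule latin_square_add_mod)
    show "\<bar>real (i_Hmod d) - 3 * 4 ^ d - real d * 3 ^ (d + 1)\<bar> \<le> (K + 78) * (3 - 1/20) ^ d"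
      using card_avoiding_triples_approx [OF \<epsilon>(2) K(2)]
      by (simp add: i_Hmod_eq finite_V latin_square_axioms)
  qed
qed

end
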